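(* Let $\alpha\in(0,2)$ and $C_1,C_2,C_3>0$. Let $\mathfrak{L}=\mathcal{L}^\mu$, where $\mu$ is a nonnegative symmetric Radon measure on $\mathbb{R}^N\setminus\{0\}$ with $\int_{|z|\le1}|z|^2d\mu(z)+\int_{|z|>1}d\mu(z)<\infty$ whose density satisfies $$\frac{C_1}{|z|^{N+\alpha}}\mathbf{1}_{|z|\le1}\le\frac{d\mu}{dz}(z)\le\frac{C_2}{|z|^{N+\alpha}}\mathbf{1}_{|z|\le1}\ \text{ (for }|z|\le1)\qquad\text{and}\qquad\frac{d\mu}{dz}(z)\le C_3\mathbf{1}_{|z|>1}\ \text{ (for }|z|>1).$$ Then there exists a constant $C>0$ such that $$\mathbb{H}_{-\mathcal{L}^\mu}^{x_0}(x,t)\le Ct^{-\frac N\alpha}e^t,$$ and, moreover, $$\|\mathbb{G}_{I-\mathcal{L}^\mu}^{x_0}\|_{L^p(\mathbb{R}^N)}=\|\mathbb{G}_{I-\mathcal{L}^\mu}^{0}\|_{L^p(\mathbb{R}^N)}\le C_p<\infty$$ for some $p\in(1,N/(N-\alpha))$.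
   Context: Throughout $N\ge3$. $\mathcal{L}^\mu[\psi](x):=P.V.\int_{\mathbb{R}^N\setminus\{0\}}(\psi(x+z)-\psi(x))\,d\mu(z)$ for $\psi\in C_{\rm c}^\infty(\mathbb{R}^N)$. $\mathbb{H}_{-\mathcal{L}^\mu}^{x_0}(x,t)=\mathbb{H}_{-\mathcal{L}^\mu}^{0}(x-x_0,t)$ is the heat kernel, i.e. the kernel of the solution semigroup of $\partial_tu+(-\mathcal{L}^\mu)[u]=0$, and $\mathbb{G}_{I-\mathcal{L}^\mu}^{x_0}(x)=\int_0^\infty e^{-t}\mathbb{H}_{-\mathcal{L}^\mu}^{x_0}(x,t)\,dt$ is the Green function of $I-\mathcal{L}^\mu$. *)

theory Defs
  imports "HOL-Analysis.Analysis"
begin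

section \<open>Test functions\<close>

text \<open>
  \<open>C_k k f\<close> says that \<open>f\<close> is of class \<open>C\<^sup>k\<close> on the whole space: \<open>f\<close> is of class \<open>C\<^sup>k\<^sup>+\<^sup>1\<close> iff it is
  differentiable and all its directional derivatives are of class \<open>C\<^sup>k\<close>.
\<close>

primrec C_k :: "nat \<Rightarrow> ('a::euclidean_space \<Rightarrow> real) \<Rightarrow> bool" where
  "C_k 0 f \<longleftrightarrow> continuous_on UNIV f"
| "C_k (Suc k) f \<longleftrightarrow>
     (\<forall>x. f differentiable (at x)) \<and> (\<forall>v. C_k k (\<lambda>x. frechet_derivative f (at x) v))"

definition test_fun :: "('a::euclidean_space \<Rightarrow> real) \<Rightarrow> bool" where
  "test_fun f \<longleftrightarrow> (\<forall>k. C_k k f) \<and> compact (closure {x. f x \<noteq> 0})"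


section \<open>The measures and the operators they generate\<close>

text \<open>
  Nonnegative symmetric Radon measures on the punctured space; they live on the Borel sets of
  \<open>- {0}\<close>, not on those of the whole space.
\<close>

definition radon_punctured :: "'a::euclidean_space measure \<Rightarrow> bool" where
  "radon_punctured \<mu> \<longleftrightarrow>
     sets \<mu> = sets (restrict_space borel (- {0})) \<and>
     (\<forall>K. compact K \<and> K \<subseteq> - {0} \<longrightarrow> emeasure \<mu> K < \<infinity>) \<and>
     (\<forall>A\<in>sets \<mu>. emeasure \<mu> A = (SUP K\<in>{K. K \<subseteq> A \<and> compact K}. emeasure \<mu> K))"

definition symmetric_measure :: "'a::euclidean_space measure \<Rightarrow> bool" where
  "symmetric_measure \<mu> \<longleftrightarrow> (\<forall>A\<in>sets \<mu>. emeasure \<mu> (uminus ` A) = emeasure \<mu> A)"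

definition levy_integrable :: "'a::euclidean_space measure \<Rightarrow> bool" where
  "levy_integrable \<mu> \<longleftrightarrow>
     (\<integral>\<^sup>+z\<in>{z. norm z \<le> 1}. ennreal ((norm z)\<^sup>2) \<partial>\<mu>) + (\<integral>\<^sup>+z\<in>{z. norm z > 1}. 1 \<partial>\<mu>) < \<infinity>"

abbreviation lborel_punctured :: "'a::euclidean_space measure" where
  "lborel_punctured \<equiv> restrict_space lborel (- {0})"

text \<open>
  The operator, with the principal value taken at the origin. The formula is meaningful not only for
  test functions but for all bounded functions of class \<open>C\<^sup>2\<close>, in particular for the solutions below.
\<close>

definition levy_op :: "'a::euclidean_space measure \<Rightarrow> ('a \<Rightarrow> real) \<Rightarrow> 'a \<Rightarrow> real" where
  "levy_op \<mu> \<psi> x =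
     Lim (at_right 0) (\<lambda>\<epsilon>. LINT z:{z. norm z > \<epsilon>}|\<mu>. \<psi> (x + z) - \<psi> x)"


section \<open>Heat kernel and Green function\<close>

definition solves_heat_eq ::
  "'a::euclidean_space measure \<Rightarrow> ('a \<Rightarrow> real) \<Rightarrow> ('a \<Rightarrow> real \<Rightarrow> real) \<Rightarrow> bool" where
  "solves_heat_eq \<mu> u0 u \<longleftrightarrow>
     (\<forall>x. \<forall>t>0. ((\<lambda>s. u x s) has_real_derivative levy_op \<mu> (\<lambda>y. u y t) x) (at t)) \<and>
     (\<forall>x. ((\<lambda>t. u x t) \<longlongrightarrow> u0 x) (at_right 0))"

text \<open>
  \<open>H x t\<close> is the heat kernel centred at the origin. The operators mapping \<open>u\<^sub>0\<close> to
  \<open>H(\<cdot>, t) * u\<^sub>0\<close> form a semigroup of positive contractions (the first four clauses) and solve the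
  Cauchy problem for \<open>\<partial>\<^sub>t u = levy_op \<mu> u\<close> (the last one). The kernel \<open>H(\<cdot>, t)\<close> of such operators is
  determined only up to null sets; requiring the semigroup identity at every point, as usual for
  transition densities, singles out one version, so that pointwise bounds make sense.
\<close>

definition heat_kernel :: "'a::euclidean_space measure \<Rightarrow> ('a \<Rightarrow> real \<Rightarrow> real) \<Rightarrow> bool" where
  "heat_kernel \<mu> H \<longleftrightarrow>
     (\<lambda>(x, t). H x t) \<in> borel_measurable (restrict_space borel (UNIV \<times> {0<..})) \<and>
     (\<forall>x. \<forall>t>0. H x t \<ge> 0) \<and>
     (\<forall>t>0. integrable lborel (\<lambda>x. H x t) \<and> (\<integral>x. H x t \<partial>lborel) \<le> 1) \<and>
     (\<forall>x. \<forall>s>0. \<forall>t>0. H x (s + t) = (\<integral>y. H (x - y) s * H y t \<partial>lborel)) \<and>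
     (\<forall>u0. test_fun u0 \<longrightarrow> solves_heat_eq \<mu> u0 (\<lambda>x t. \<integral>y. H (x - y) t * u0 y \<partial>lborel))"

definition heat_kernel_at :: "('a::euclidean_space \<Rightarrow> real \<Rightarrow> real) \<Rightarrow> 'a \<Rightarrow> 'a \<Rightarrow> real \<Rightarrow> real" where
  "heat_kernel_at H x0 x t = H (x - x0) t"

text \<open>
  The Green function of \<open>I - levy_op \<mu>\<close> built from the heat kernel; it is extended-valued because
  it may be infinite at its centre.
\<close>

definition green :: "('a::euclidean_space \<Rightarrow> real \<Rightarrow> real) \<Rightarrow> 'a \<Rightarrow> 'a \<Rightarrow> ennreal" where
  "green H x0 x = (\<integral>\<^sup>+t\<in>{0<..}. ennreal (exp (- t) * heat_kernel_at H x0 x t) \<partial>lborel)"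

text \<open>Powers and \<open>L\<^sup>p\<close> norms of extended nonnegative functions; used for positive exponents only.\<close>

definition epowr :: "ennreal \<Rightarrow> real \<Rightarrow> ennreal" where
  "epowr a p = (if a = \<infinity> then \<infinity> else ennreal (enn2real a powr p))"

definition Lp_norm :: "real \<Rightarrow> ('a::euclidean_space \<Rightarrow> ennreal) \<Rightarrow> ennreal" where
  "Lp_norm p f = epowr (\<integral>\<^sup>+x. epowr (f x) p \<partial>lborel) (1 / p)"

end

theory Submission
  imports Defs
begin

text \<open>
  The kernel bound comes from the maximum principle. Let \<open>u = H(\<cdot>, t) * u\<^sub>0\<close> be the solution with a
  nonnegative test function as initial datum. It is bounded, continuous, vanishes at infinity and
  keeps mass at most \<open>m\<close>, the mass of \<open>u\<^sub>0\<close>. At a point \<open>x\<close> where \<open>u(\<cdot>, t)\<close> is maximal every increment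
  \<open>u(x + z) - u(x)\<close> is nonpositive, so only the \<open>z\<close> in an annulus of radius \<open>r \<le> 1\<close> need to be kept,
  where the density is at least \<open>C1 / r\<^sup>N\<^sup>+\<^sup>\<alpha>\<close>. This yields
  \<open>\<partial>\<^sub>t u(x) \<le> - C1 r\<^sup>-\<^sup>N\<^sup>-\<^sup>\<alpha> (c r\<^sup>N u(x) - m)\<close> (lemma \<open>levy_op_le_at_max\<close>). With \<open>r\<^sup>\<alpha> = k t\<close> for a
  suitable \<open>k\<close>, the function \<open>B m t powr (- N/\<alpha>)\<close> is a strict supersolution, and a solution
  cannot touch it before time \<open>1/k\<close> (lemma \<open>sol_le_power\<close>).

  The bound holds for all nonnegative test functions, so \<open>H(\<cdot>, t)\<close> itself is bounded almost everywhere
  (lemma \<open>AE_le_of_test_fun\<close>), and everywhere, with the time range extended to all \<open>t > 0\<close>, by the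
  semigroup identity (lemma \<open>heat_kernel_le\<close>).

  For the Green function take \<open>p = 1 + \<alpha>/(2N)\<close>. By Jensen's inequality for the measure \<open>e\<^sup>-\<^sup>t dt\<close>, the
  \<open>p\<close>-th power of its norm is at most the \<open>e\<^sup>-\<^sup>t dt\<close>-integral of the \<open>p\<close>-th powers of the norms of
  \<open>H(\<cdot>, t)\<close>. Since \<open>H(\<cdot>, t)\<close> has mass at most \<open>1\<close>, those are at most the \<open>(p-1)\<close>-st power of the
  supremum bound, a constant times \<open>t\<^sup>-\<^sup>1\<^sup>/\<^sup>2 e\<^sup>(\<^sup>p\<^sup>-\<^sup>1\<^sup>)\<^sup>t\<close>, and the resulting integral converges (lemma
  \<open>Lp_norm_green_finite\<close>). The norm does not depend on the centre by translation invariance.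
\<close>

section \<open>Regularity and supply of test functions\<close>

lemma frechet_derivative_eq_0_outside:
  fixes f :: "'a::euclidean_space \<Rightarrow> real"
  assumes "closed K" "\<And>x. x \<notin> K \<Longrightarrow> f x = 0" "x \<notin> K"
  shows "frechet_derivative f (at x) v = 0"
proof -
  have "((\<lambda>_. 0) has_derivative (\<lambda>_. 0)) (at x)" by simp
  then have "(f has_derivative (\<lambda>_. 0)) (at x)"
    by (rule has_derivative_transform_within_open[where s = "- K"]) (use assms in auto)
  from frechet_derivative_at[OF this] show ?thesis by metis
qed

text \<open>
  Derivatives of \<open>f\<close> vanish off the support as well, so a continuous directional derivative is
  bounded; the Lipschitz bound follows from the mean value inequality.
\<close>

lemma C1_compact_support_imp_lipschitz:
  fixes f :: "'a::euclidean_space \<Rightarrow> real"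
  assumes f: "C_k (Suc 0) f" and K: "compact K" and 0: "\<And>x. x \<notin> K \<Longrightarrow> f x = 0"
  obtains L where "L \<ge> 0" "\<And>x y. \<bar>f x - f y\<bar> \<le> L * norm (x - y)"
proof -
  let ?D = "\<lambda>x. frechet_derivative f (at x)"
  have der: "(f has_derivative ?D x) (at x)" for x
    using f frechet_derivative_works by auto
  have "\<exists>L\<ge>0. \<forall>x. \<bar>?D x v\<bar> \<le> L" for v
  proof -
    have "continuous_on K (\<lambda>x. ?D x v)"
      using f by (auto intro: continuous_on_subset)
    then have "bounded ((\<lambda>x. ?D x v) ` K)"
      using K compact_continuous_image compact_imp_bounded by blast
    then obtain L where L: "L > 0" "\<And>x. x \<in> K \<Longrightarrow> \<bar>?D x v\<bar> \<le> L"
      by (auto simp: bounded_pos)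
    have "\<bar>?D x v\<bar> \<le> L" for x
      using L frechet_derivative_eq_0_outside[OF compact_imp_closed[OF K] 0, where x = x and v = v]
      by (cases "x \<in> K") auto
    with L show ?thesis by (meson less_imp_le)
  qed
  then obtain L where L: "\<And>v. L v \<ge> 0" "\<And>v x. \<bar>?D x v\<bar> \<le> L v" by metis
  let ?L = "\<Sum>i\<in>Basis. L i"
  have "onorm (?D x) \<le> ?L" for x
  proof -
    have "onorm (?D x) \<le> (\<Sum>i\<in>Basis. norm (?D x i))"
      by (rule onorm_componentwise) (use der has_derivative_bounded_linear in blast)
    also have "\<dots> \<le> ?L" by (intro sum_mono) (auto simp: L)
    finally show ?thesis .
  qed
  then have "norm (f x - f y) \<le> ?L * norm (x - y)" for x y
    by (intro differentiable_bound[where S = UNIV and f' = ?D]) (auto simp: der)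
  moreover have "?L \<ge> 0" by (simp add: sum_nonneg L)
  ultimately show ?thesis using that by auto
qed

text \<open>
  This estimate carries all the second-order regularity that the argument extracts from the initial data: it is
  inherited by convolutions, and it makes the principal value converge absolutely after
  symmetrisation.
\<close>

lemma C2_compact_support_second_difference:
  fixes f :: "'a::euclidean_space \<Rightarrow> real"
  assumes f: "C_k (Suc (Suc 0)) f" and K: "compact K" and 0: "\<And>x. x \<notin> K \<Longrightarrow> f x = 0"
  obtains L where "L \<ge> 0" "\<And>x z. \<bar>f (x + z) + f (x - z) - 2 * f x\<bar> \<le> L * (norm z)\<^sup>2"
proof -
  let ?D = "\<lambda>x. frechet_derivative f (at x)"
  have der: "(f has_derivative ?D x) (at x)" for x
    using f frechet_derivative_works by auto
  have "\<exists>L\<ge>0. \<forall>x y. \<bar>?D x v - ?D y v\<bar> \<le> L * norm (x - y)" for v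
  proof -
    have "C_k (Suc 0) (\<lambda>x. ?D x v)" using f by auto
    moreover have "?D x v = 0" if "x \<notin> K" for x
      using frechet_derivative_eq_0_outside[OF compact_imp_closed[OF K] 0 that] .
    ultimately obtain L where "L \<ge> 0" "\<And>x y. \<bar>?D x v - ?D y v\<bar> \<le> L * norm (x - y)"
      using C1_compact_support_imp_lipschitz[OF _ K] by blast
    then show ?thesis by blast
  qed
  then obtain L where L: "\<And>v. L v \<ge> 0" "\<And>v x y. \<bar>?D x v - ?D y v\<bar> \<le> L v * norm (x - y)"
    by metis
  let ?L = "\<Sum>i\<in>Basis. L i"
  have lin: "?D x v = (\<Sum>i\<in>Basis. (v \<bullet> i) * ?D x i)" for x v
  proof -
    interpret linear "?D x" using der has_derivative_linear by blast
    have "?D x v = ?D x (\<Sum>i\<in>Basis. (v \<bullet> i) *\<^sub>R i)" by (simp add: euclidean_representation)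
    also have "\<dots> = (\<Sum>i\<in>Basis. (v \<bullet> i) * ?D x i)" by (simp add: sum scale)
    finally show ?thesis .
  qed
  have Dlip: "\<bar>?D x v - ?D y v\<bar> \<le> norm v * ?L * norm (x - y)" for x y v
  proof -
    have "?D x v - ?D y v = (\<Sum>i\<in>Basis. (v \<bullet> i) * (?D x i - ?D y i))"
      unfolding lin[of x v] lin[of y v] by (simp add: sum_subtractf right_diff_distrib)
    also have "\<bar>\<dots>\<bar> \<le> (\<Sum>i\<in>Basis. norm v * (L i * norm (x - y)))"
    proof (intro sum_abs[THEN order_trans] sum_mono)
      fix i :: 'a assume "i \<in> Basis"
      then show "\<bar>(v \<bullet> i) * (?D x i - ?D y i)\<bar> \<le> norm v * (L i * norm (x - y))"
        unfolding abs_mult by (intro mult_mono Basis_le_norm L) auto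
    qed
    finally show ?thesis by (simp add: sum_distrib_left sum_distrib_right algebra_simps)
  qed
  have "\<bar>f (x + z) + f (x - z) - 2 * f x\<bar> \<le> (2 * ?L) * (norm z)\<^sup>2" for x z
  proof -
    define g where "g s = f (x + s *\<^sub>R z) + f (x - s *\<^sub>R z)" for s :: real
    have gd: "(g has_real_derivative (?D (x + s *\<^sub>R z) z - ?D (x - s *\<^sub>R z) z)) (at s)" for s
    proof -
      have a: "((\<lambda>s. x + s *\<^sub>R z) has_derivative (\<lambda>h. h *\<^sub>R z)) (at s)"
        "((\<lambda>s. x - s *\<^sub>R z) has_derivative (\<lambda>h. - (h *\<^sub>R z))) (at s)"
        by (auto intro!: derivative_eq_intros)
      have lin2: "linear (?D y)" for y using der has_derivative_linear by blast
      have b: "(g has_derivative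
         (\<lambda>h. ?D (x + s *\<^sub>R z) (h *\<^sub>R z) + ?D (x - s *\<^sub>R z) (- (h *\<^sub>R z)))) (at s)"
        unfolding g_def
        using has_derivative_add[OF has_derivative_compose[OF a(1) der] has_derivative_compose[OF a(2) der]] .
      show ?thesis
        unfolding has_field_derivative_def
        by (rule has_derivative_eq_rhs[OF b])
           (auto simp: linear_scale[OF lin2] linear_neg[OF lin2] algebra_simps)
    qed
    then obtain s where s: "0 < s" "s < 1" "g 1 - g 0 = ?D (x + s *\<^sub>R z) z - ?D (x - s *\<^sub>R z) z"
      using MVT2[of 0 1 g "\<lambda>s. ?D (x + s *\<^sub>R z) z - ?D (x - s *\<^sub>R z) z"] by auto
    have "(x + s *\<^sub>R z) - (x - s *\<^sub>R z) = (2 * s) *\<^sub>R z"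
      by (simp add: scaleR_2 flip: scaleR_scaleR)
    then have "norm ((x + s *\<^sub>R z) - (x - s *\<^sub>R z)) \<le> 2 * norm z"
      using s by (simp add: mult_left_le_one_le)
    then have "norm z * ?L * norm ((x + s *\<^sub>R z) - (x - s *\<^sub>R z)) \<le> norm z * ?L * (2 * norm z)"
      by (intro mult_left_mono mult_nonneg_nonneg sum_nonneg L norm_ge_zero)
    with Dlip[of "x + s *\<^sub>R z" z "x - s *\<^sub>R z"]
    have "\<bar>g 1 - g 0\<bar> \<le> norm z * ?L * (2 * norm z)" unfolding s(3) by linarith
    then show ?thesis by (simp add: g_def power2_eq_square algebra_simps)
  qed
  moreover have "2 * ?L \<ge> 0" by (simp add: sum_nonneg L)
  ultimately show ?thesis using that by blast
qed

text \<open>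
  The functions \<open>e\<^sup>-\<^sup>1\<^sup>/\<^sup>s / s\<^sup>j\<close>, extended by \<open>0\<close> to \<open>s \<le> 0\<close>. The family is closed under
  differentiation up to linear combinations.
\<close>

definition flat :: "nat \<Rightarrow> real \<Rightarrow> real" where
  "flat j s = (if s \<le> 0 then 0 else exp (- 1 / s) / s ^ j)"

lemma flat_has_derivative:
  "(flat j has_real_derivative (flat (j + 2) s - real j * flat (j + 1) s)) (at s)"
proof -
  consider "s < 0" | "s = 0" | "s > 0" by linarith
  then show ?thesis
  proof cases
    case 1
    have "((\<lambda>_. 0 :: real) has_real_derivative 0) (at s)" by simp
    then have "(flat j has_real_derivative 0) (at s)"
      by (rule has_field_derivative_transform_within_open[where S = "{..<0}"])
         (use 1 in \<open>auto simp: flat_def\<close>)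
    then show ?thesis using 1 by (simp add: flat_def)
  next
    case 3
    have "((\<lambda>s. exp (- 1 / s) / s ^ j) has_real_derivative
           flat (j + 2) s - real j * flat (j + 1) s) (at s)"
      using 3
      apply (cases j)
       apply (auto intro!: derivative_eq_intros simp: flat_def field_simps power2_eq_square)
      subgoal for n by (cases n) auto
      done
    then show ?thesis
      by (rule has_field_derivative_transform_within_open[where S = "{0<..}"])
         (use 3 in \<open>auto simp: flat_def\<close>)
  next
    case 2
    have "((\<lambda>h. flat j h / h) \<longlongrightarrow> 0) (at_right 0)"
    proof -
      have "((\<lambda>h. inverse h ^ Suc j / exp (inverse h)) \<longlongrightarrow> 0) (at_right (0::real))"
        by (rule filterlim_compose[OF tendsto_power_div_exp_0 filterlim_inverse_at_top_right])
      then show ?thesis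
        by (rule Lim_transform_eventually)
           (auto simp: flat_def eventually_at_right_field exp_minus field_simps intro!: exI[of _ 1])
    qed
    moreover have "((\<lambda>h. flat j h / h) \<longlongrightarrow> 0) (at_left 0)"
      by (rule tendsto_eventually) (auto simp: flat_def eventually_at_left_field intro!: exI[of _ "-1"])
    ultimately have "((\<lambda>h. flat j h / h) \<longlongrightarrow> 0) (at 0)"
      by (simp add: filterlim_split_at)
    then show ?thesis using 2 by (simp add: DERIV_def flat_def)
  qed
qed

text \<open>
  A class of functions that is visibly closed under directional derivatives, hence consists of
  \<open>C\<^sup>\<infinity>\<close> functions, and that is rich enough to contain bump functions of balls.
\<close>

inductive elementary_smooth :: "('a::euclidean_space \<Rightarrow> real) \<Rightarrow> bool" where
  const: "elementary_smooth (\<lambda>x. c)"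
| inner: "elementary_smooth (\<lambda>x. x \<bullet> v)"
| add: "elementary_smooth f \<Longrightarrow> elementary_smooth g \<Longrightarrow> elementary_smooth (\<lambda>x. f x + g x)"
| mult: "elementary_smooth f \<Longrightarrow> elementary_smooth g \<Longrightarrow> elementary_smooth (\<lambda>x. f x * g x)"
| flat: "elementary_smooth f \<Longrightarrow> elementary_smooth (\<lambda>x. flat j (f x))"

lemma elementary_smooth_has_derivative:
  assumes "elementary_smooth f"
  shows "\<exists>f'. (\<forall>x. (f has_derivative f' x) (at x)) \<and> (\<forall>v. elementary_smooth (\<lambda>x. f' x v))"
  using assms
proof induction
  case (const c)
  show ?case by (rule exI[of _ "\<lambda>_ _. 0"]) (auto intro: elementary_smooth.const)
next
  case (inner w)
  show ?case
    by (rule exI[of _ "\<lambda>_ v. v \<bullet> w"])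
       (auto intro!: derivative_eq_intros elementary_smooth.const)
next
  case (add f g)
  then obtain f' g' where
    "\<forall>x. (f has_derivative f' x) (at x)" "\<forall>v. elementary_smooth (\<lambda>x. f' x v)"
    "\<forall>x. (g has_derivative g' x) (at x)" "\<forall>v. elementary_smooth (\<lambda>x. g' x v)" by blast
  then show ?case
    by (intro exI[of _ "\<lambda>x v. f' x v + g' x v"])
       (auto intro!: has_derivative_add elementary_smooth.add)
next
  case (mult f g)
  then obtain f' g' where
    "\<forall>x. (f has_derivative f' x) (at x)" "\<forall>v. elementary_smooth (\<lambda>x. f' x v)"
    "\<forall>x. (g has_derivative g' x) (at x)" "\<forall>v. elementary_smooth (\<lambda>x. g' x v)" by blast
  with mult show ?case
    by (intro exI[of _ "\<lambda>x v. f x * g' x v + f' x v * g x"])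
       (auto intro!: has_derivative_mult elementary_smooth.add elementary_smooth.mult)
next
  case (flat f j)
  then obtain f' where f':
    "\<forall>x. (f has_derivative f' x) (at x)" "\<forall>v. elementary_smooth (\<lambda>x. f' x v)" by blast
  let ?g = "\<lambda>x. flat (j + 2) (f x) + (- real j) * flat (j + 1) (f x)"
  have "((\<lambda>x. flat j (f x)) has_derivative (\<lambda>v. ?g x * f' x v)) (at x)" for x
    using has_derivative_compose[OF f'(1)[rule_format]
        flat_has_derivative[of j "f x", unfolded has_field_derivative_def]] by simp
  moreover have "elementary_smooth ?g"
    by (intro elementary_smooth.intros flat)
  ultimately show ?case
    using f' by (intro exI[of _ "\<lambda>x v. ?g x * f' x v"]) (auto intro!: elementary_smooth.mult)
qed

lemma elementary_smooth_C_k: "elementary_smooth f \<Longrightarrow> C_k k f"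
proof (induction k arbitrary: f)
  case 0
  then obtain f' where "\<forall>x. (f has_derivative f' x) (at x)"
    using elementary_smooth_has_derivative by blast
  then show ?case
    by (auto simp: continuous_on_eq_continuous_at intro: has_derivative_continuous)
next
  case (Suc k)
  then obtain f' where f':
    "\<forall>x. (f has_derivative f' x) (at x)" "\<forall>v. elementary_smooth (\<lambda>x. f' x v)"
    using elementary_smooth_has_derivative by blast
  then have "frechet_derivative f (at x) = f' x" for x
    using frechet_derivative_at by metis
  with f' Suc.IH show ?case by (auto simp: differentiable_def)
qed

lemma elementary_smooth_prod:
  "(\<And>i. i \<in> I \<Longrightarrow> elementary_smooth (f i)) \<Longrightarrow> elementary_smooth (\<lambda>x. \<Prod>i\<in>I. f i x)"
  by (induction I rule: infinite_finite_induct) (auto intro: elementary_smooth.intros)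

lemma elementary_smooth_sum:
  "(\<And>i. i \<in> I \<Longrightarrow> elementary_smooth (f i)) \<Longrightarrow> elementary_smooth (\<lambda>x. \<Sum>i\<in>I. f i x)"
  by (induction I rule: infinite_finite_induct) (auto intro: elementary_smooth.intros)

lemma open_eq_UN_balls:
  fixes U :: "'a::euclidean_space set"
  assumes "open U"
  obtains a :: "nat \<Rightarrow> 'a" and r :: "nat \<Rightarrow> real" where "U = (\<Union>i. ball (a i) (r i))"
proof (cases "U = {}")
  case True
  then show ?thesis using that[of "\<lambda>_. 0" "\<lambda>_. 0"] by simp
next
  case False
  let ?F = "{ball x r | x r. ball x r \<subseteq> U}"
  have U: "\<Union> ?F = U"
  proof (intro equalityI subsetI)
    fix x assume "x \<in> U"
    then obtain e where "e > 0" "ball x e \<subseteq> U" using assms open_contains_ball by metis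
    then have "x \<in> ball x e" "ball x e \<in> ?F" by auto
    then show "x \<in> \<Union> ?F" by (rule UnionI[rotated])
  qed auto
  have "open S" if "S \<in> ?F" for S using that by auto
  then obtain F' where F': "F' \<subseteq> ?F" "countable F'" "\<Union> F' = \<Union> ?F"
    by (rule Lindelof)
  then have ne: "F' \<noteq> {}" using False U by auto
  have "\<exists>x r. from_nat_into F' i = ball x r" for i
    using subsetD[OF F'(1) from_nat_into[OF ne, of i]] by blast
  then obtain a r where ar: "\<And>i. from_nat_into F' i = ball (a i) (r i)" by metis
  have "U = (\<Union>i. from_nat_into F' i)"
    using F'(3) U range_from_nat_into[OF ne F'(2)] by simp
  then show ?thesis using that ar by simp
qed

text \<open>
  The set is written as a countable union of balls. Each ball indicator is approximated by bumps
  \<open>\<psi> n i\<close> that sharpen as \<open>n \<rightarrow> \<infinity>\<close>, and the bumps of the first \<open>n\<close> balls are combined into the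
  smooth substitute \<open>1 - (\<Prod>i<n. 1 - \<psi> n i x)\<close> of their maximum.
\<close>

lemma test_fun_tendsto_indicator_open:
  fixes U :: "'a::euclidean_space set"
  assumes "open U"
  obtains \<phi> :: "nat \<Rightarrow> 'a \<Rightarrow> real" where
    "\<And>n. test_fun (\<phi> n)" "\<And>n x. 0 \<le> \<phi> n x" "\<And>n x. \<phi> n x \<le> indicator U x"
    "\<And>x. (\<lambda>n. \<phi> n x) \<longlonglongrightarrow> indicator U x"
proof -
  obtain a :: "nat \<Rightarrow> 'a" and r' where U': "U = (\<Union>i. ball (a i) (r' i))"
    using open_eq_UN_balls[OF assms] .
  \<comment> \<open>Nonnegative radii allow distances to be compared through their squares.\<close>
  define r where "r i = max 0 (r' i)" for i
  have U: "U = (\<Union>i. ball (a i) (r i))"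
    unfolding U' r_def by (intro SUP_cong refl) (auto simp: max_def)
  define \<psi> where "\<psi> n i x = flat 0 (real (Suc n) * ((r i)\<^sup>2 - (norm (x - a i))\<^sup>2))" for n i x
  define \<phi> where "\<phi> n x = 1 - (\<Prod>i<n. 1 - \<psi> n i x)" for n x
  have \<psi>01: "0 \<le> \<psi> n i x" "\<psi> n i x \<le> 1" for n i x
    by (auto simp: \<psi>_def flat_def)
  have \<psi>_out: "\<psi> n i x = 0" if "x \<notin> ball (a i) (r i)" for n i x
  proof -
    have "r i \<le> norm (x - a i)" using that by (simp add: dist_norm norm_minus_commute)
    then have "(r i)\<^sup>2 \<le> (norm (x - a i))\<^sup>2" by (intro power_mono) (auto simp: r_def)
    then show ?thesis
      by (auto simp: \<psi>_def flat_def zero_less_mult_iff not_le)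
  qed
  have \<psi>_es: "elementary_smooth (\<psi> n i)" for n i
  proof -
    have "(norm (x - a i))\<^sup>2 = (\<Sum>j\<in>Basis. (x \<bullet> j + (- (a i \<bullet> j))) * (x \<bullet> j + (- (a i \<bullet> j))))" for x
      unfolding power2_norm_eq_inner
      by (subst euclidean_inner) (simp add: inner_diff_left)
    then have eq: "\<psi> n i = (\<lambda>x. flat 0 (real (Suc n) * ((r i)\<^sup>2 +
         (- 1) * (\<Sum>j\<in>Basis. (x \<bullet> j + (- (a i \<bullet> j))) * (x \<bullet> j + (- (a i \<bullet> j)))))))"
      by (simp add: \<psi>_def fun_eq_iff)
    show ?thesis
      unfolding eq by (intro elementary_smooth.intros elementary_smooth_sum)
  qed
  have prod01: "0 \<le> (\<Prod>i<n. 1 - \<psi> n i x)" "(\<Prod>i<n. 1 - \<psi> n i x) \<le> 1" for n x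
    using \<psi>01 by (auto intro!: prod_nonneg prod_le_1)
  have out: "\<phi> n x = 0" if "x \<notin> (\<Union>i<n. ball (a i) (r i))" for n x
    using that by (auto simp: \<phi>_def \<psi>_out intro!: prod.neutral)
  have test: "test_fun (\<phi> n)" for n
  proof -
    have "\<phi> n = (\<lambda>x. 1 + (- 1) * (\<Prod>i<n. 1 + (- 1) * \<psi> n i x))"
      by (simp add: \<phi>_def fun_eq_iff)
    moreover have "elementary_smooth (\<lambda>x. 1 + (- 1) * (\<Prod>i<n. 1 + (- 1) * \<psi> n i x))"
      by (intro elementary_smooth.intros elementary_smooth_prod \<psi>_es)
    ultimately have "elementary_smooth (\<phi> n)" by simp
    moreover have "compact (closure {x. \<phi> n x \<noteq> 0})"
    proof -
      have "bounded (\<Union>i<n. ball (a i) (r i))" by auto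
      moreover have "{x. \<phi> n x \<noteq> 0} \<subseteq> (\<Union>i<n. ball (a i) (r i))" using out by blast
      ultimately show ?thesis using bounded_subset compact_closure by blast
    qed
    ultimately show ?thesis by (auto simp: test_fun_def elementary_smooth_C_k)
  qed
  have le: "\<phi> n x \<le> indicator U x" for n x
    using prod01[where x = x and n = n] out[of x n] by (auto simp: \<phi>_def U indicator_def)
  have lim: "(\<lambda>n. \<phi> n x) \<longlonglongrightarrow> indicator U x" for x
  proof (cases "x \<in> U")
    case False
    then have "\<phi> n x = 0" for n by (intro out) (auto simp: U)
    then show ?thesis using False by simp
  next
    case True
    then obtain i where i: "x \<in> ball (a i) (r i)" by (auto simp: U)
    define s where "s = (r i)\<^sup>2 - (norm (x - a i))\<^sup>2"
    have "norm (x - a i) < r i" using i by (simp add: dist_norm norm_minus_commute)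
    then have s: "s > 0" unfolding s_def by (simp add: power_strict_mono)
    have "(\<lambda>n. exp (- (inverse (real (Suc n)) * (1 / s)))) \<longlonglongrightarrow> exp (- (0 * (1 / s)))"
      by (intro tendsto_intros LIMSEQ_inverse_real_of_nat)
    moreover have "exp (- (inverse (real (Suc n)) * (1 / s))) = \<psi> n i x" for n
    proof -
      have "real (Suc n) * s > 0" using s by (simp del: of_nat_Suc)
      then show ?thesis
        by (simp add: \<psi>_def flat_def s_def[symmetric] inverse_eq_divide del: of_nat_Suc)
    qed
    ultimately have \<psi>lim: "(\<lambda>n. \<psi> n i x) \<longlonglongrightarrow> 1" by simp
    have "\<psi> n i x \<le> \<phi> n x" if "n > i" for n
    proof -
      have "(\<Prod>j<n. 1 - \<psi> n j x) = (1 - \<psi> n i x) * (\<Prod>j\<in>{..<n} - {i}. 1 - \<psi> n j x)"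
        using that by (subst prod.remove[of _ i]) auto
      also have "\<dots> \<le> (1 - \<psi> n i x) * 1"
        by (intro mult_left_mono prod_le_1) (use \<psi>01 in auto)
      finally show ?thesis by (simp add: \<phi>_def)
    qed
    then have "eventually (\<lambda>n. \<psi> n i x \<le> \<phi> n x) sequentially"
      by (rule eventually_mono[OF eventually_gt_at_top[of i]])
    moreover have "eventually (\<lambda>n. \<phi> n x \<le> 1) sequentially"
      using prod01 by (auto simp: \<phi>_def)
    ultimately have "(\<lambda>n. \<phi> n x) \<longlonglongrightarrow> 1"
      by (rule tendsto_sandwich[OF _ _ \<psi>lim tendsto_const])
    then show ?thesis using True by simp
  qed
  have nonneg: "0 \<le> \<phi> n x" for n x using prod01 by (simp add: \<phi>_def)
  show ?thesis by (rule that[OF test nonneg le lim])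
qed

lemma test_fun_compact_support:
  assumes "test_fun f"
  obtains K where "compact K" "\<And>x. x \<notin> K \<Longrightarrow> f x = 0"
proof
  show "compact (closure {x. f x \<noteq> 0})" using assms by (simp add: test_fun_def)
  show "f x = 0" if "x \<notin> closure {x. f x \<noteq> 0}" for x
    using that closure_subset[of "{x. f x \<noteq> 0}"] by auto
qed

lemma test_fun_continuous: "test_fun f \<Longrightarrow> continuous_on UNIV f"
  unfolding test_fun_def using C_k.simps(1) by blast

lemma test_fun_measurable: "test_fun f \<Longrightarrow> f \<in> borel_measurable borel"
  by (intro borel_measurable_continuous_onI test_fun_continuous)

lemma test_fun_bounded:
  assumes "test_fun f"
  obtains M where "M \<ge> 0" "\<And>x. \<bar>f x\<bar> \<le> M"
proof -
  obtain K where K: "compact K" "\<And>x. x \<notin> K \<Longrightarrow> f x = 0"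
    using test_fun_compact_support[OF assms] by blast
  have "bounded (f ` K)"
    using K test_fun_continuous[OF assms]
    by (meson compact_continuous_image compact_imp_bounded continuous_on_subset subset_UNIV)
  then obtain M where M: "M > 0" "\<And>x. x \<in> K \<Longrightarrow> \<bar>f x\<bar> \<le> M"
    by (auto simp: bounded_pos)
  have "\<bar>f x\<bar> \<le> M" for x using M K(2)[of x] by (cases "x \<in> K") auto
  with M(1) show ?thesis by (intro that[of M]) auto
qed

lemma test_fun_integrable:
  assumes "test_fun f"
  shows "integrable lborel f"
proof -
  obtain K where K: "compact K" "\<And>x. x \<notin> K \<Longrightarrow> f x = 0"
    using test_fun_compact_support[OF assms] by blast
  have "integrable lborel (\<lambda>x. indicator K x *\<^sub>R f x)"
    by (intro borel_integrable_compact K continuous_on_subset[OF test_fun_continuous[OF assms]]) auto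
  also have "(\<lambda>x. indicator K x *\<^sub>R f x) = f" using K(2) by (auto simp: fun_eq_iff indicator_def)
  finally show ?thesis .
qed

lemma test_fun_lipschitz:
  assumes "test_fun f"
  obtains L where "L \<ge> 0" "\<And>x y. \<bar>f x - f y\<bar> \<le> L * norm (x - y)"
proof -
  obtain K where K: "compact K" "\<And>x. x \<notin> K \<Longrightarrow> f x = 0"
    using test_fun_compact_support[OF assms] by blast
  have "C_k (Suc 0) f" using assms unfolding test_fun_def by blast
  from C1_compact_support_imp_lipschitz[OF this K] that show ?thesis by blast
qed

lemma test_fun_second_difference:
  assumes "test_fun f"
  obtains L where "L \<ge> 0" "\<And>x z. \<bar>f (x + z) + f (x - z) - 2 * f x\<bar> \<le> L * (norm z)\<^sup>2"
proof -
  obtain K where K: "compact K" "\<And>x. x \<notin> K \<Longrightarrow> f x = 0"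
    using test_fun_compact_support[OF assms] by blast
  have "C_k (Suc (Suc 0)) f" using assms unfolding test_fun_def by blast
  from C2_compact_support_second_difference[OF this K] that show ?thesis by blast
qed

section \<open>Convolution with sub-probability densities\<close>

lemma distr_lborel_minus:
  fixes x :: "'a::euclidean_space"
  shows "distr lborel borel (\<lambda>y. x - y) = lborel"
  using lborel_affine[of "-1" x] by (simp add: density_1)

lemma lborel_integral_minus:
  fixes g :: "'a::euclidean_space \<Rightarrow> real"
  assumes [measurable]: "g \<in> borel_measurable borel"
  shows "(\<integral>y. g (x - y) \<partial>lborel) = (\<integral>y. g y \<partial>lborel)"
  by (subst (2) distr_lborel_minus[of x, symmetric]) (simp add: integral_distr)

lemma lborel_integrable_minus:
  fixes g :: "'a::euclidean_space \<Rightarrow> real"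
  assumes "integrable lborel g"
  shows "integrable lborel (\<lambda>y. g (x - y))"
proof -
  have [measurable]: "g \<in> borel_measurable borel" using assms by auto
  show ?thesis
    using assms by (subst (asm) distr_lborel_minus[of x, symmetric]) (simp add: integrable_distr_eq)
qed

lemma lborel_nn_integral_translate:
  fixes g :: "'a::euclidean_space \<Rightarrow> ennreal"
  assumes [measurable]: "g \<in> borel_measurable borel"
  shows "(\<integral>\<^sup>+y. g (x + y) \<partial>lborel) = (\<integral>\<^sup>+y. g y \<partial>lborel)"
  by (subst (2) lborel_distr_plus[of x, symmetric]) (simp add: nn_integral_distr)

text \<open>
  Densities of sub-probability measures; every time slice of a heat kernel is one.
\<close>

definition sub_density :: "('a::euclidean_space \<Rightarrow> real) \<Rightarrow> bool" where
  "sub_density h \<longleftrightarrow> integrable lborel h \<and> (\<forall>x. 0 \<le> h x) \<and> (\<integral>x. h x \<partial>lborel) \<le> 1"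

text \<open>
  Convolution, with the kernel in the first argument. The integral is Bochner's, hence \<open>0\<close> where
  the integrand is not integrable; this does not occur for bounded measurable \<open>f\<close>.
\<close>

definition conv :: "('a::euclidean_space \<Rightarrow> real) \<Rightarrow> ('a \<Rightarrow> real) \<Rightarrow> 'a \<Rightarrow> real" where
  "conv h f x = (\<integral>y. h (x - y) * f y \<partial>lborel)"

lemma sub_density_measurable: "sub_density h \<Longrightarrow> h \<in> borel_measurable borel"
  by (auto simp: sub_density_def)

lemma conv_eq:
  assumes h: "sub_density h" and f: "f \<in> borel_measurable borel"
  shows "conv h f x = (\<integral>y. h y * f (x - y) \<partial>lborel)"
proof -
  note [measurable] = sub_density_measurable[OF h] f
  show ?thesis unfolding conv_def
    by (subst lborel_integral_minus[of "\<lambda>y. h y * f (x - y)" x, symmetric]) auto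
qed

lemma integrable_sub_density_mult:
  assumes h: "sub_density h" and f: "f \<in> borel_measurable borel" "\<And>x. \<bar>f x\<bar> \<le> M"
  shows "integrable lborel (\<lambda>y. h y * f y)"
proof (rule Bochner_Integration.integrable_bound)
  note [measurable] = sub_density_measurable[OF h] f(1)
  show "(\<lambda>y. h y * f y) \<in> borel_measurable lborel" by simp
  show "integrable lborel (\<lambda>y. h y * M)" using h by (simp add: sub_density_def)
  show "AE y in lborel. norm (h y * f y) \<le> norm (h y * M)"
    using f(2) by (intro AE_I2) (auto simp: abs_mult intro!: mult_left_mono order_trans[OF f(2)])
qed

lemma abs_integral_sub_density_le:
  assumes h: "sub_density h" and f: "f \<in> borel_measurable borel" "\<And>x. \<bar>f x\<bar> \<le> M"
  shows "\<bar>\<integral>y. h y * f y \<partial>lborel\<bar> \<le> M"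
proof -
  have M: "M \<ge> 0" using f(2)[of 0] by linarith
  have "\<bar>\<integral>y. h y * f y \<partial>lborel\<bar> \<le> (\<integral>y. \<bar>h y * f y\<bar> \<partial>lborel)" by (rule integral_abs_bound)
  also have "\<dots> \<le> (\<integral>y. h y * M \<partial>lborel)"
    using h f(2) by (intro integral_mono integrable_abs integrable_sub_density_mult[OF assms])
      (auto simp: sub_density_def abs_mult intro!: mult_left_mono)
  also have "\<dots> = (\<integral>y. h y \<partial>lborel) * M" by simp
  also have "\<dots> \<le> 1 * M" using h M by (intro mult_right_mono) (auto simp: sub_density_def)
  finally show ?thesis by simp
qed

lemma abs_conv_le:
  assumes "sub_density h" "f \<in> borel_measurable borel" "\<And>x. \<bar>f x\<bar> \<le> M"
  shows "\<bar>conv h f x\<bar> \<le> M"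
proof -
  note [measurable] = assms(2)
  show ?thesis unfolding conv_eq[OF assms(1,2)]
    by (rule abs_integral_sub_density_le) (use assms in auto)
qed

lemma conv_nonneg: "sub_density h \<Longrightarrow> (\<And>x. 0 \<le> f x) \<Longrightarrow> 0 \<le> conv h f x"
  by (auto simp: conv_def sub_density_def intro!: integral_nonneg_AE)

lemma conv_lipschitz:
  assumes h: "sub_density h" and f: "test_fun f" and L: "\<And>x y. \<bar>f x - f y\<bar> \<le> L * norm (x - y)"
  shows "\<bar>conv h f x - conv h f y\<bar> \<le> L * norm (x - y)"
proof -
  note [measurable] = test_fun_measurable[OF f]
  obtain M where M: "\<And>x. \<bar>f x\<bar> \<le> M" using test_fun_bounded[OF f] by metis
  have i: "integrable lborel (\<lambda>y. h y * f (x - y))" for x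
    by (rule integrable_sub_density_mult[OF h]) (use M in auto)
  have "conv h f x - conv h f y = (\<integral>w. h w * (f (x - w) - f (y - w)) \<partial>lborel)"
    unfolding conv_eq[OF h test_fun_measurable[OF f]]
    by (subst Bochner_Integration.integral_diff[symmetric]) (auto simp: i right_diff_distrib)
  also have "\<bar>\<dots>\<bar> \<le> L * norm (x - y)"
    using L[of "x - w" "y - w" for w] by (intro abs_integral_sub_density_le[OF h]) auto
  finally show ?thesis .
qed

lemma conv_continuous:
  assumes h: "sub_density h" and f: "test_fun f"
  shows "continuous_on UNIV (conv h f)"
proof -
  obtain L where L: "L \<ge> 0" "\<And>x y. \<bar>f x - f y\<bar> \<le> L * norm (x - y)"
    using test_fun_lipschitz[OF f] by blast
  have "L-lipschitz_on UNIV (conv h f)"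
    using L(1) conv_lipschitz[OF h f L(2)] by (intro lipschitz_onI) (auto simp: dist_norm)
  then show ?thesis by (rule lipschitz_on_continuous_on)
qed

lemma conv_second_difference:
  assumes h: "sub_density h" and f: "test_fun f"
    and L: "\<And>x z. \<bar>f (x + z) + f (x - z) - 2 * f x\<bar> \<le> L * (norm z)\<^sup>2"
  shows "\<bar>conv h f (x + z) + conv h f (x - z) - 2 * conv h f x\<bar> \<le> L * (norm z)\<^sup>2"
proof -
  note [measurable] = test_fun_measurable[OF f]
  obtain M where M: "\<And>x. \<bar>f x\<bar> \<le> M" using test_fun_bounded[OF f] by metis
  have i: "integrable lborel (\<lambda>y. h y * f (x - y))" for x
    by (rule integrable_sub_density_mult[OF h]) (use M in auto)
  let ?g = "\<lambda>w. f (x + z - w) + f (x - z - w) - 2 * f (x - w)"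
  have "(\<integral>w. h w * ?g w \<partial>lborel) =
      (\<integral>w. (h w * f (x + z - w) + h w * f (x - z - w)) - 2 * (h w * f (x - w)) \<partial>lborel)"
    by (intro Bochner_Integration.integral_cong) (auto simp: algebra_simps)
  also have "\<dots> = conv h f (x + z) + conv h f (x - z) - 2 * conv h f x"
    unfolding conv_eq[OF h test_fun_measurable[OF f]] using i by simp
  finally have "conv h f (x + z) + conv h f (x - z) - 2 * conv h f x = (\<integral>w. h w * ?g w \<partial>lborel)"
    by simp
  also have "\<bar>\<dots>\<bar> \<le> L * (norm z)\<^sup>2"
  proof (rule abs_integral_sub_density_le[OF h])
    show "\<bar>?g w\<bar> \<le> L * (norm z)\<^sup>2" for w
      using L[of "x - w" z] by (simp add: algebra_simps)
  qed auto
  finally show ?thesis .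
qed

lemma conv_integral_le:
  assumes h: "sub_density h" and f: "test_fun f" "\<And>x. 0 \<le> f x"
  shows "integrable lborel (conv h f)" "(\<integral>x. conv h f x \<partial>lborel) \<le> (\<integral>x. f x \<partial>lborel)"
proof -
  note [measurable] = test_fun_measurable[OF f(1)] sub_density_measurable[OF h]
    borel_measurable_continuous_onI[OF conv_continuous[OF h f(1)]]
  have h0: "h x \<ge> 0" for x using h by (simp add: sub_density_def)
  obtain M where M: "\<And>x. \<bar>f x\<bar> \<le> M" using test_fun_bounded[OF f(1)] by metis
  have i: "integrable lborel (\<lambda>y. h y * f (x - y))" for x
    by (rule integrable_sub_density_mult[OF h]) (use M in auto)
  have intf: "integrable lborel f" by (rule test_fun_integrable[OF f(1)])
  have "(\<integral>\<^sup>+x. ennreal (conv h f x) \<partial>lborel)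
      = (\<integral>\<^sup>+x. (\<integral>\<^sup>+y. ennreal (h y * f (x - y)) \<partial>lborel) \<partial>lborel)"
    unfolding conv_eq[OF h test_fun_measurable[OF f(1)]]
    using i f(2) h0 by (intro nn_integral_cong nn_integral_eq_integral[symmetric]) auto
  also have "\<dots> = (\<integral>\<^sup>+y. (\<integral>\<^sup>+x. ennreal (h y * f (x - y)) \<partial>lborel) \<partial>lborel)"
    by (intro lborel_pair.Fubini') measurable
  also have "\<dots> = (\<integral>\<^sup>+y. ennreal (h y) * (\<integral>\<^sup>+x. ennreal (f x) \<partial>lborel) \<partial>lborel)"
  proof (intro nn_integral_cong)
    fix y
    have "(\<integral>\<^sup>+x. ennreal (h y * f (x - y)) \<partial>lborel) = ennreal (h y) * (\<integral>\<^sup>+x. ennreal (f (- y + x)) \<partial>lborel)"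
      by (simp add: ennreal_mult h0 f(2) nn_integral_cmult)
    also have "(\<integral>\<^sup>+x. ennreal (f (- y + x)) \<partial>lborel) = (\<integral>\<^sup>+x. ennreal (f x) \<partial>lborel)"
      by (rule lborel_nn_integral_translate) simp
    finally show "(\<integral>\<^sup>+x. ennreal (h y * f (x - y)) \<partial>lborel) = ennreal (h y) * (\<integral>\<^sup>+x. ennreal (f x) \<partial>lborel)" .
  qed
  also have "\<dots> = (\<integral>\<^sup>+y. ennreal (h y) \<partial>lborel) * (\<integral>\<^sup>+x. ennreal (f x) \<partial>lborel)"
    by (simp add: nn_integral_multc)
  also have "(\<integral>\<^sup>+y. ennreal (h y) \<partial>lborel) = ennreal (\<integral>y. h y \<partial>lborel)"
    using h h0 by (intro nn_integral_eq_integral) (auto simp: sub_density_def)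
  also have "\<dots> * (\<integral>\<^sup>+x. ennreal (f x) \<partial>lborel) \<le> 1 * (\<integral>\<^sup>+x. ennreal (f x) \<partial>lborel)"
    using h by (intro mult_right_mono) (auto simp: sub_density_def)
  also have "\<dots> = ennreal (\<integral>x. f x \<partial>lborel)"
    using intf f(2) by (simp add: nn_integral_eq_integral)
  finally have le: "(\<integral>\<^sup>+x. ennreal (conv h f x) \<partial>lborel) \<le> ennreal (\<integral>x. f x \<partial>lborel)" .
  have c0: "conv h f x \<ge> 0" for x by (rule conv_nonneg[OF h f(2)])
  show int: "integrable lborel (conv h f)"
    by (rule integrableI_nonneg) (use le c0 in \<open>auto simp: top_unique le_less_trans[OF le]\<close>)
  show "(\<integral>x. conv h f x \<partial>lborel) \<le> (\<integral>x. f x \<partial>lborel)"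
    using le by (simp add: nn_integral_eq_integral[OF int] c0 f(2) integral_nonneg_AE)
qed

lemma conv_vanishes_at_infinity:
  assumes h: "sub_density h" and f: "test_fun f" and e: "e > 0"
  obtains R where "\<And>x. norm x > R \<Longrightarrow> \<bar>conv h f x\<bar> < e"
proof -
  note [measurable] = test_fun_measurable[OF f] sub_density_measurable[OF h]
  have h0: "h x \<ge> 0" for x using h by (simp add: sub_density_def)
  have inth: "integrable lborel h" using h by (simp add: sub_density_def)
  obtain M where M: "M \<ge> 0" "\<And>x. \<bar>f x\<bar> \<le> M" using test_fun_bounded[OF f] by blast
  obtain K where K: "compact K" "\<And>x. x \<notin> K \<Longrightarrow> f x = 0"
    using test_fun_compact_support[OF f] by blast
  obtain r where r: "\<And>x. x \<in> K \<Longrightarrow> norm x \<le> r"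
    using compact_imp_bounded[OF K(1)] by (auto simp: bounded_iff)
  let ?T = "\<lambda>n y. h y * (M * indicator {y. norm y > real n} y)"
  have "(\<lambda>n. \<integral>y. ?T n y \<partial>lborel) \<longlonglongrightarrow> (\<integral>y. 0 \<partial>(lborel :: 'a measure))"
  proof (rule integral_dominated_convergence)
    show "AE y in lborel. (\<lambda>n. ?T n y) \<longlonglongrightarrow> 0"
    proof (intro AE_I2 tendsto_eventually)
      fix y :: 'a
      obtain N where "norm y \<le> real N" using real_arch_simple by blast
      then show "\<forall>\<^sub>F n in sequentially. ?T n y = 0"
        by (intro eventually_sequentiallyI[of N]) (auto simp: indicator_def)
    qed
    show "integrable lborel (\<lambda>y. h y * M)" using inth by simp
  qed (use h0 M in \<open>auto simp: indicator_def\<close>)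
  then have "eventually (\<lambda>n. (\<integral>y. ?T n y \<partial>lborel) < e) sequentially"
    using e by (intro order_tendstoD(2)) auto
  then obtain n where n: "(\<integral>y. ?T n y \<partial>lborel) < e"
    by (auto simp: eventually_sequentially)
  have "\<bar>conv h f x\<bar> < e" if x: "norm x > r + real n" for x
  proof -
    have "\<bar>conv h f x\<bar> \<le> (\<integral>y. \<bar>h y * f (x - y)\<bar> \<partial>lborel)"
      unfolding conv_eq[OF h test_fun_measurable[OF f]] by (rule integral_abs_bound)
    also have "\<dots> \<le> (\<integral>y. ?T n y \<partial>lborel)"
    proof (intro integral_mono)
      show "integrable lborel (\<lambda>y. \<bar>h y * f (x - y)\<bar>)"
        by (intro integrable_abs integrable_sub_density_mult[OF h]) (use M in auto)
      show "integrable lborel (?T n)"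
        by (intro integrable_sub_density_mult[OF h, where M = M]) (use M in \<open>auto simp: indicator_def\<close>)
      fix y
      show "\<bar>h y * f (x - y)\<bar> \<le> ?T n y"
      proof (cases "x - y \<in> K")
        case True
        then have "norm (x - y) \<le> r" by (rule r)
        then have "norm y > real n" using x norm_triangle_ineq[of "x - y" y] by simp
        then show ?thesis using h0[of y] M by (auto simp: abs_mult intro!: mult_left_mono)
      qed (use K(2) h0[of y] M(1) in auto)
    qed
    also note n
    finally show ?thesis .
  qed
  then show ?thesis by (rule that)
qed

section \<open>The operator on bounded functions with bounded second differences\<close>

lemma radon_punctured_measurable:
  "radon_punctured \<mu> \<Longrightarrow> f \<in> borel_measurable borel \<Longrightarrow> f \<in> borel_measurable \<mu>"
  using measurable_cong_sets[of \<mu> "restrict_space borel (- {0})" borel borel]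
  by (auto simp: radon_punctured_def intro: measurable_restrict_space1)

lemma space_radon_punctured: "radon_punctured \<mu> \<Longrightarrow> space \<mu> = - {0}"
  using sets_eq_imp_space_eq[of \<mu> "restrict_space borel (- {0})"]
  by (auto simp: radon_punctured_def)

lemma symmetric_measure_integral:
  fixes g :: "'a::euclidean_space \<Rightarrow> real"
  assumes \<mu>: "radon_punctured \<mu>" "symmetric_measure \<mu>" and g: "g \<in> borel_measurable borel"
  shows "(\<integral>z. g (- z) \<partial>\<mu>) = (\<integral>z. g z \<partial>\<mu>)"
proof -
  have meas: "uminus \<in> measurable \<mu> \<mu>"
  proof -
    have "uminus \<in> measurable (restrict_space borel (- {0})) (restrict_space borel (- {0 :: 'a}))"
      by (intro measurable_restrict_space3) auto
    then show ?thesis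
      using \<mu>(1) measurable_cong_sets by (metis radon_punctured_def)
  qed
  have "distr \<mu> \<mu> uminus = \<mu>"
  proof (rule measure_eqI)
    fix A assume A: "A \<in> sets (distr \<mu> \<mu> uminus)"
    then have "A \<subseteq> space \<mu>" using sets.sets_into_space by auto
    then have "uminus -` A \<inter> space \<mu> = uminus ` A"
      unfolding space_radon_punctured[OF \<mu>(1)] by (force simp: image_iff minus_equation_iff)
    then show "emeasure (distr \<mu> \<mu> uminus) A = emeasure \<mu> A"
      using A meas \<mu>(2) by (simp add: emeasure_distr symmetric_measure_def)
  qed simp
  then show ?thesis
    using integral_distr[OF meas radon_punctured_measurable[OF \<mu>(1) g]] by simp
qed

lemma levy_weight_integrable:
  assumes \<mu>: "radon_punctured \<mu>" "levy_integrable \<mu>"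
  shows "integrable \<mu> (\<lambda>z. min 1 ((norm z)\<^sup>2))"
proof (rule integrableI_nonneg)
  let ?A = "{z. norm z \<le> 1}" and ?B = "{z. norm z > 1}"
  have m: "(\<lambda>z. ennreal ((norm z)\<^sup>2) * indicator ?A z) \<in> borel_measurable \<mu>"
    "(\<lambda>z. 1 * indicator ?B z :: ennreal) \<in> borel_measurable \<mu>"
    by (intro radon_punctured_measurable[OF \<mu>(1)]; measurable)+
  have "(\<integral>\<^sup>+z. ennreal (min 1 ((norm z)\<^sup>2)) \<partial>\<mu>)
      \<le> (\<integral>\<^sup>+z. ennreal ((norm z)\<^sup>2) * indicator ?A z + 1 * indicator ?B z \<partial>\<mu>)"
    by (intro nn_integral_mono) (auto simp: indicator_def not_le intro!: ennreal_leI)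
  also have "\<dots> = (\<integral>\<^sup>+z\<in>?A. ennreal ((norm z)\<^sup>2) \<partial>\<mu>) + (\<integral>\<^sup>+z\<in>?B. 1 \<partial>\<mu>)"
    by (intro nn_integral_add m)
  also have "\<dots> < \<infinity>" using \<mu>(2) by (simp add: levy_integrable_def)
  finally show "(\<integral>\<^sup>+z. ennreal (min 1 ((norm z)\<^sup>2)) \<partial>\<mu>) < \<infinity>" .
qed (auto intro: radon_punctured_measurable[OF \<mu>(1)])

lemma levy_truncated_integrable:
  fixes g :: "'a::euclidean_space \<Rightarrow> real"
  assumes \<mu>: "radon_punctured \<mu>" "levy_integrable \<mu>" and "\<epsilon> > 0"
    and g: "g \<in> borel_measurable borel" "\<And>z. \<bar>g z\<bar> \<le> M"
  shows "integrable \<mu> (\<lambda>z. indicator {z. norm z > \<epsilon>} z * g z)"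
proof (rule Bochner_Integration.integrable_bound)
  let ?c = "M * max 1 (1 / \<epsilon>\<^sup>2)"
  have M: "M \<ge> 0" using g(2)[of 0] by linarith
  show "integrable \<mu> (\<lambda>z. ?c * min 1 ((norm z)\<^sup>2))"
    by (intro integrable_mult_right levy_weight_integrable[OF \<mu>])
  show "(\<lambda>z. indicator {z. norm z > \<epsilon>} z * g z) \<in> borel_measurable \<mu>"
    using g(1) by (intro radon_punctured_measurable[OF \<mu>(1)]) measurable
  show "AE z in \<mu>. norm (indicator {z. norm z > \<epsilon>} z * g z) \<le> norm (?c * min 1 ((norm z)\<^sup>2))"
  proof (intro AE_I2)
    fix z :: 'a
    have nn: "0 \<le> ?c * min 1 ((norm z)\<^sup>2)" using M by (intro mult_nonneg_nonneg) auto
    show "norm (indicator {z. norm z > \<epsilon>} z * g z) \<le> norm (?c * min 1 ((norm z)\<^sup>2))"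
    proof (cases "norm z > \<epsilon>")
      case True
      have "1 \<le> max 1 (1 / \<epsilon>\<^sup>2) * min 1 ((norm z)\<^sup>2)"
      proof (cases "norm z \<ge> 1")
        case True
        then have "1 \<le> (norm z)\<^sup>2" by simp
        then show ?thesis by simp
      next
        case False
        then have "min 1 ((norm z)\<^sup>2) = (norm z)\<^sup>2" by (simp add: power_le_one min_absorb2)
        moreover have "1 / \<epsilon>\<^sup>2 * (norm z)\<^sup>2 \<ge> 1"
          using True \<open>\<epsilon> > 0\<close> by (simp add: field_simps power_mono)
        moreover have "1 / \<epsilon>\<^sup>2 * (norm z)\<^sup>2 \<le> max 1 (1 / \<epsilon>\<^sup>2) * (norm z)\<^sup>2"
          by (intro mult_right_mono) auto
        ultimately show ?thesis by linarith
      qed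
      then have "M * 1 \<le> M * (max 1 (1 / \<epsilon>\<^sup>2) * min 1 ((norm z)\<^sup>2))"
        using M by (intro mult_left_mono)
      then show ?thesis using True g(2)[of z] nn by (simp add: mult.assoc)
    qed (use nn in auto)
  qed
qed

text \<open>
  By symmetry of the measure the truncated integrals equal those of half the second difference of
  \<open>u\<close>, which is dominated by a multiple of \<open>min 1 |z|\<^sup>2\<close>. Hence the limit in the definition of the
  operator exists, with a bound that depends on \<open>u\<close> only through \<open>M\<close> and \<open>L\<close>.
\<close>

lemma levy_op_of_second_difference_bound:
  fixes u :: "'a::euclidean_space \<Rightarrow> real"
  assumes \<mu>: "radon_punctured \<mu>" "symmetric_measure \<mu>" "levy_integrable \<mu>"
    and u: "u \<in> borel_measurable borel" "\<And>x. \<bar>u x\<bar> \<le> M"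
    and L: "\<And>z. \<bar>u (x + z) + u (x - z) - 2 * u x\<bar> \<le> L * (norm z)\<^sup>2"
  shows "((\<lambda>\<epsilon>. LINT z:{z. norm z > \<epsilon>}|\<mu>. u (x + z) - u x) \<longlongrightarrow> levy_op \<mu> u x) (at_right 0)"
    and "\<bar>levy_op \<mu> u x\<bar> \<le> (L + 4 * M) * (\<integral>z. min 1 ((norm z)\<^sup>2) \<partial>\<mu>)"
proof -
  note [measurable] = u(1)
  let ?w = "\<lambda>z::'a. min 1 ((norm z)\<^sup>2)"
  define g where "g z = (u (x + z) + u (x - z) - 2 * u x) / 2" for z
  have M: "M \<ge> 0" using u(2)[of 0] by linarith
  \<comment> \<open>The bound \<open>L\<close> is nonnegative since it holds at a unit vector.\<close>
  have L0: "L \<ge> 0"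
  proof -
    obtain b :: 'a where "b \<in> Basis" using nonempty_Basis by blast
    then have "norm b = 1" by simp
    with L[of b] show ?thesis by simp
  qed
  have gm: "g \<in> borel_measurable borel" unfolding g_def by measurable
  have gb: "\<bar>g z\<bar> \<le> (L + 4 * M) * ?w z" for z
  proof (cases "norm z \<le> 1")
    case True
    then have w: "?w z = (norm z)\<^sup>2" by (simp add: power_le_one min_absorb2)
    have "0 \<le> L * (norm z)\<^sup>2" "0 \<le> M * (norm z)\<^sup>2" using L0 M by auto
    then show ?thesis unfolding w using L[of z] by (simp add: g_def distrib_right)
  next
    case False
    then have w: "?w z = 1" by simp
    show ?thesis unfolding w using u(2)[of "x + z"] u(2)[of "x - z"] u(2)[of x] L0
      by (simp add: g_def)
  qed
  have gi: "integrable \<mu> g"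
  proof (rule Bochner_Integration.integrable_bound)
    show "integrable \<mu> (\<lambda>z. (L + 4 * M) * ?w z)"
      by (intro integrable_mult_right levy_weight_integrable \<mu>)
    show "AE z in \<mu>. norm (g z) \<le> norm ((L + 4 * M) * ?w z)"
      using order_trans[OF gb abs_ge_self] by simp
  qed (rule radon_punctured_measurable[OF \<mu>(1) gm])
  have eq: "(LINT z:{z. norm z > \<epsilon>}|\<mu>. u (x + z) - u x) = (\<integral>z. indicator {z. norm z > \<epsilon>} z * g z \<partial>\<mu>)"
    if "\<epsilon> > 0" for \<epsilon>
  proof -
    let ?F = "\<lambda>z. indicator {z. norm z > \<epsilon>} z * (u (x + z) - u x)"
    have b: "\<bar>u (x + z) - u x\<bar> \<le> 2 * M" "\<bar>u (x - z) - u x\<bar> \<le> 2 * M" for z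
      using u(2)[of "x + z"] u(2)[of "x - z"] u(2)[of x] by linarith+
    have i: "integrable \<mu> ?F" "integrable \<mu> (\<lambda>z. ?F (- z))"
      using levy_truncated_integrable[OF \<mu>(1,3) that, of "\<lambda>z. u (x + z) - u x" "2 * M"]
        levy_truncated_integrable[OF \<mu>(1,3) that, of "\<lambda>z. u (x - z) - u x" "2 * M"] b
      by (simp_all add: indicator_def)
    have "(\<integral>z. ?F (- z) \<partial>\<mu>) = (\<integral>z. ?F z \<partial>\<mu>)"
      by (rule symmetric_measure_integral[OF \<mu>(1,2)]) measurable
    then have "(\<integral>z. ?F z \<partial>\<mu>) = ((\<integral>z. ?F z \<partial>\<mu>) + (\<integral>z. ?F (- z) \<partial>\<mu>)) / 2" by simp
    also have "\<dots> = (\<integral>z. (?F z + ?F (- z)) / 2 \<partial>\<mu>)"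
      using i by simp
    also have "\<dots> = (\<integral>z. indicator {z. norm z > \<epsilon>} z * g z \<partial>\<mu>)"
      by (intro Bochner_Integration.integral_cong) (auto simp: g_def indicator_def)
    finally show ?thesis by (simp add: set_lebesgue_integral_def)
  qed
  have lim: "((\<lambda>\<epsilon>. \<integral>z. indicator {z. norm z > \<epsilon>} z * g z \<partial>\<mu>) \<longlongrightarrow> (\<integral>z. g z \<partial>\<mu>)) (at_right 0)"
  proof (rule tendsto_at_right_sequentially[of 0 1])
    fix S :: "nat \<Rightarrow> real" assume S: "\<And>n. 0 < S n" "S \<longlonglongrightarrow> 0"
    show "(\<lambda>n. \<integral>z. indicator {z. norm z > S n} z * g z \<partial>\<mu>) \<longlonglongrightarrow> (\<integral>z. g z \<partial>\<mu>)"
    proof (rule integral_dominated_convergence)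
      show "integrable \<mu> (\<lambda>z. \<bar>g z\<bar>)" using gi by simp
      show "AE z in \<mu>. (\<lambda>n. indicator {z. norm z > S n} z * g z) \<longlonglongrightarrow> g z"
      proof (intro AE_I2 tendsto_eventually)
        fix z assume "z \<in> space \<mu>"
        then have "norm z > 0" using space_radon_punctured[OF \<mu>(1)] by auto
        from order_tendstoD(2)[OF S(2) this]
        show "\<forall>\<^sub>F n in sequentially. indicator {z. norm z > S n} z * g z = g z"
          by (rule eventually_mono) simp
      qed
    qed (use gm in \<open>auto intro!: radon_punctured_measurable[OF \<mu>(1)] simp: indicator_def\<close>)
  qed auto
  have "((\<lambda>\<epsilon>. LINT z:{z. norm z > \<epsilon>}|\<mu>. u (x + z) - u x) \<longlongrightarrow> (\<integral>z. g z \<partial>\<mu>)) (at_right 0)"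
    by (rule Lim_transform_eventually[OF lim])
       (auto simp: eq eventually_at_right_field intro!: exI[of _ 1])
  moreover from this have op: "levy_op \<mu> u x = (\<integral>z. g z \<partial>\<mu>)"
    unfolding levy_op_def by (intro tendsto_Lim) auto
  ultimately show "((\<lambda>\<epsilon>. LINT z:{z. norm z > \<epsilon>}|\<mu>. u (x + z) - u x) \<longlongrightarrow> levy_op \<mu> u x) (at_right 0)"
    by simp
  have "\<bar>\<integral>z. g z \<partial>\<mu>\<bar> \<le> (\<integral>z. \<bar>g z\<bar> \<partial>\<mu>)" by (rule integral_abs_bound)
  also have "\<dots> \<le> (\<integral>z. (L + 4 * M) * ?w z \<partial>\<mu>)"
    using gi gb by (intro integral_mono integrable_abs integrable_mult_right levy_weight_integrable \<mu>)
  finally show "\<bar>levy_op \<mu> u x\<bar> \<le> (L + 4 * M) * (\<integral>z. ?w z \<partial>\<mu>)" unfolding op by simp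
qed

lemma levy_measure_ge_near_0:
  fixes \<mu> :: "'a::euclidean_space measure"
  assumes \<mu>: "radon_punctured \<mu>" and ac: "absolutely_continuous lborel_punctured \<mu>"
    and near: "AE z in lborel_punctured. norm z \<le> 1 \<longrightarrow>
        ennreal (C1 / norm z powr s) \<le> RN_deriv lborel_punctured \<mu> z"
    and s: "s \<ge> 0" and C1: "C1 \<ge> 0" and r: "0 < r" "r \<le> 1"
    and A: "A \<in> sets borel" "\<And>z. z \<in> A \<Longrightarrow> 0 < norm z \<and> norm z \<le> r"
    and f: "f \<in> borel_measurable borel"
  shows "ennreal (C1 / r powr s) * (\<integral>\<^sup>+z\<in>A. f z \<partial>lborel) \<le> (\<integral>\<^sup>+z\<in>A. f z \<partial>\<mu>)"
proof -
  note [measurable] = A(1) f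
  let ?P = "lborel_punctured :: 'a measure"
  let ?R = "RN_deriv ?P \<mu>"
  have "sigma_finite_measure ?P"
    by (intro sigma_finite_measure_restrict_space lborel.sigma_finite_measure_axioms) auto
  moreover have "sets \<mu> = sets ?P"
    using \<mu> sets_restrict_space_cong[of borel lborel "- {0}"] by (simp add: radon_punctured_def)
  ultimately have dens: "density ?P ?R = \<mu>"
    using ac sigma_finite_measure.density_RN_deriv by blast
  have m: "(\<lambda>z. f z * indicator A z) \<in> borel_measurable ?P"
    by (rule measurable_restrict_space1) simp
  have "(\<integral>\<^sup>+z\<in>A. f z \<partial>lborel) = (\<integral>\<^sup>+z. f z * indicator A z * indicator (- {0}) z \<partial>lborel)"
    using A(2)[of 0] by (intro nn_integral_cong) (auto simp: indicator_def)
  also have "\<dots> = (\<integral>\<^sup>+z. f z * indicator A z \<partial>?P)"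
    by (subst nn_integral_restrict_space) auto
  finally have "ennreal (C1 / r powr s) * (\<integral>\<^sup>+z\<in>A. f z \<partial>lborel)
      = (\<integral>\<^sup>+z. ennreal (C1 / r powr s) * (f z * indicator A z) \<partial>?P)"
    using m by (simp add: nn_integral_cmult)
  also have "\<dots> \<le> (\<integral>\<^sup>+z. ?R z * (f z * indicator A z) \<partial>?P)"
  proof (intro nn_integral_mono_AE, use near in eventually_elim)
    fix z assume z: "norm z \<le> 1 \<longrightarrow> ennreal (C1 / norm z powr s) \<le> ?R z"
    show "ennreal (C1 / r powr s) * (f z * indicator A z) \<le> ?R z * (f z * indicator A z)"
    proof (cases "z \<in> A")
      case True
      with A(2)[of z] r s have n: "0 < norm z" "norm z \<le> 1" "norm z powr s \<le> r powr s"
        by (auto intro!: powr_mono2)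
      then have "C1 / r powr s \<le> C1 / norm z powr s"
        using C1 by (intro divide_left_mono mult_pos_pos) (auto simp: r)
      then have "ennreal (C1 / r powr s) \<le> ?R z"
        using z n(2) by (auto intro: order_trans[OF ennreal_leI])
      then show ?thesis by (rule mult_right_mono) simp
    qed simp
  qed
  also have "\<dots> = (\<integral>\<^sup>+z. f z * indicator A z \<partial>density ?P ?R)"
    by (rule nn_integral_density[symmetric]) (use m in auto)
  finally show ?thesis by (simp only: dens)
qed

text \<open>
  At a maximum point all increments are nonpositive, so the integral over the whole space is at most
  the one over the annulus \<open>r/2 < |z| < r\<close>. There the measure has density at least
  \<open>C1 / r powr s\<close>, and the Lebesgue integral of the increments is the mass of \<open>u\<close> near \<open>x\<close>, at most
  the total mass, minus \<open>u x\<close> times the volume of the annulus, which is at least half that of the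
  ball of radius \<open>r\<close>.
\<close>

lemma levy_op_le_at_max:
  fixes u :: "'a::euclidean_space \<Rightarrow> real"
  assumes \<mu>: "radon_punctured \<mu>" "symmetric_measure \<mu>" "levy_integrable \<mu>"
    and ac: "absolutely_continuous lborel_punctured \<mu>"
    and near: "AE z in lborel_punctured. norm z \<le> 1 \<longrightarrow>
        ennreal (C1 / norm z powr s) \<le> RN_deriv lborel_punctured \<mu> z"
    and s: "s \<ge> 0" and C1: "C1 \<ge> 0" and r: "0 < r" "r \<le> 1"
    and u: "integrable lborel u" "\<And>x. 0 \<le> u x" "\<And>y. u y \<le> u x"
    and L: "\<And>z. \<bar>u (x + z) + u (x - z) - 2 * u x\<bar> \<le> L * (norm z)\<^sup>2"
  shows "levy_op \<mu> u x \<le>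
    - (C1 / r powr s * (unit_ball_vol DIM('a) / 2 * r ^ DIM('a) * u x - (\<integral>y. u y \<partial>lborel)))"
    (is "_ \<le> - (?c * (?V * u x - ?I))")
proof -
  have [measurable]: "u \<in> borel_measurable borel" using u(1) by auto
  have um: "u \<in> borel_measurable borel" by simp
  have ub: "\<bar>u y\<bar> \<le> u x" for y using u(2,3)[of y] by simp
  define A where "A = ball 0 r - cball (0::'a) (r / 2)"
  have A_iff: "z \<in> A \<longleftrightarrow> norm z < r \<and> r / 2 < norm z" for z by (auto simp: A_def)
  have Am[measurable]: "A \<in> sets borel" by (simp add: A_def)
  have fin: "emeasure lborel A < \<infinity>"
    by (rule emeasure_bounded_finite) (auto simp: A_def intro: bounded_subset[OF bounded_ball])
  have vol: "?V \<le> measure lborel A"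
  proof -
    have "measure lborel A = measure lborel (ball (0::'a) r) - measure lborel (cball (0::'a) (r / 2))"
      unfolding A_def using r
      using emeasure_lborel_ball_finite[of "0::'a" r]
      by (intro measure_Diff) auto
    also have "\<dots> = unit_ball_vol DIM('a) * (r ^ DIM('a) - (r / 2) ^ DIM('a))"
      using r by (simp add: content_ball content_cball right_diff_distrib)
    finally have eq: "measure lborel A = unit_ball_vol DIM('a) * (r ^ DIM('a) - (r / 2) ^ DIM('a))" .
    have "(1 / 2 :: real) ^ DIM('a) \<le> (1 / 2) ^ 1" by (intro power_decreasing) (auto simp: Suc_leI)
    then have "r ^ DIM('a) * (1 / 2) ^ DIM('a) \<le> r ^ DIM('a) * (1 / 2)"
      using r by (intro mult_left_mono) auto
    then have "r ^ DIM('a) / 2 \<le> r ^ DIM('a) - (r / 2) ^ DIM('a)"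
      by (simp add: power_divide)
    then have "unit_ball_vol DIM('a) * (r ^ DIM('a) / 2)
        \<le> unit_ball_vol DIM('a) * (r ^ DIM('a) - (r / 2) ^ DIM('a))"
      by (intro mult_left_mono) auto
    then show ?thesis unfolding eq by simp
  qed
  define f where "f z = u x - u (x + z)" for z
  have f0: "0 \<le> f z" for z using u(3) by (simp add: f_def)
  have fM: "\<bar>f z\<bar> \<le> u x" for z using u(2)[of "x + z"] u(3)[of "x + z"] by (simp add: f_def)
  have fm[measurable]: "f \<in> borel_measurable borel" unfolding f_def by measurable
  have i1: "integrable lborel (\<lambda>z. u (x + z))"
    using lborel_integrable_minus[OF lborel_integrable_minus[OF u(1), of 0], of "- x"]
    by (simp add: add.commute)
  have iA: "integrable lborel (\<lambda>z. indicator A z * u x)"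
    using fin by (intro integrable_mult_left) (auto intro!: integrable_real_indicator)
  have iA2: "integrable lborel (\<lambda>z. indicator A z * u (x + z))"
    by (rule Bochner_Integration.integrable_bound[OF i1]) (auto simp: indicator_def)
  have intf: "integrable lborel (\<lambda>z. indicator A z * f z)"
    unfolding f_def right_diff_distrib by (intro Bochner_Integration.integrable_diff iA iA2)
  have lb: "?V * u x - ?I \<le> (\<integral>z. indicator A z * f z \<partial>lborel)"
  proof -
    have "(\<integral>z. indicator A z * f z \<partial>lborel)
        = (\<integral>z. indicator A z * u x \<partial>lborel) - (\<integral>z. indicator A z * u (x + z) \<partial>lborel)"
      unfolding f_def right_diff_distrib by (intro Bochner_Integration.integral_diff iA iA2)
    moreover have "(\<integral>z. indicator A z * u x \<partial>lborel) = measure lborel A * u x" by simp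
    moreover have "(\<integral>z. indicator A z * u (x + z) \<partial>lborel) \<le> (\<integral>z. u (x + z) \<partial>lborel)"
      by (intro integral_mono iA2 i1) (auto simp: indicator_def u(2))
    moreover have "(\<integral>z. u (x + z) \<partial>lborel) = ?I"
      by (subst (2) lborel_distr_plus[of x, symmetric]) (simp add: integral_distr)
    moreover have "?V * u x \<le> measure lborel A * u x" using vol u(2) by (rule mult_right_mono)
    ultimately show ?thesis by linarith
  qed
  have ineq: "(LINT z:{z. norm z > \<epsilon>}|\<mu>. u (x + z) - u x) \<le> - (?c * (?V * u x - ?I))"
    if \<epsilon>: "0 < \<epsilon>" "\<epsilon> < r / 2" for \<epsilon>
  proof -
    have i2: "integrable \<mu> (\<lambda>z. indicator {z. norm z > \<epsilon>} z * f z)"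
      by (rule levy_truncated_integrable[OF \<mu>(1,3) \<epsilon>(1) fm fM])
    have "integrable \<mu> (\<lambda>z. indicator {z. norm z > \<epsilon>} z * (indicator A z * f z))"
    proof (rule levy_truncated_integrable[OF \<mu>(1,3) \<epsilon>(1)])
      show "\<bar>indicator A z * f z\<bar> \<le> u x" for z using fM[of z] u(2)[of x] by (simp add: indicator_def)
    qed simp
    also have "(\<lambda>z. indicator {z. norm z > \<epsilon>} z * (indicator A z * f z)) = (\<lambda>z. indicator A z * f z)"
      using \<epsilon> by (auto simp: fun_eq_iff A_iff indicator_def)
    finally have i3: "integrable \<mu> (\<lambda>z. indicator A z * f z)" .
    have "ennreal (?c * (\<integral>z. indicator A z * f z \<partial>lborel))
        = ennreal ?c * (\<integral>\<^sup>+z. ennreal (indicator A z * f z) \<partial>lborel)"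
      using C1 f0 nn_integral_eq_integral[OF intf]
      by (subst ennreal_mult) (auto intro!: integral_nonneg_AE divide_nonneg_nonneg)
    also have "\<dots> = ennreal ?c * (\<integral>\<^sup>+z\<in>A. ennreal (f z) \<partial>lborel)"
      by (intro arg_cong2[where f = "(*)"] nn_integral_cong refl) (auto simp: indicator_def)
    also have "\<dots> \<le> (\<integral>\<^sup>+z\<in>A. ennreal (f z) \<partial>\<mu>)"
    proof (rule levy_measure_ge_near_0[OF \<mu>(1) ac near s C1 r Am])
      show "0 < norm z \<and> norm z \<le> r" if "z \<in> A" for z
        using that r by (auto simp: A_iff simp del: zero_less_norm_iff)
    qed simp
    also have "\<dots> = (\<integral>\<^sup>+z. ennreal (indicator A z * f z) \<partial>\<mu>)"
      by (intro nn_integral_cong) (auto simp: indicator_def)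
    also have "\<dots> = ennreal (\<integral>z. indicator A z * f z \<partial>\<mu>)"
      using i3 f0 by (intro nn_integral_eq_integral) auto
    finally have "?c * (\<integral>z. indicator A z * f z \<partial>lborel) \<le> (\<integral>z. indicator A z * f z \<partial>\<mu>)"
      using f0 by (simp add: integral_nonneg_AE)
    also have "\<dots> \<le> (\<integral>z. indicator {z. norm z > \<epsilon>} z * f z \<partial>\<mu>)"
      using \<epsilon> f0 by (intro integral_mono i2 i3) (auto simp: indicator_def A_iff)
    also have "\<dots> = - (LINT z:{z. norm z > \<epsilon>}|\<mu>. u (x + z) - u x)"
      unfolding set_lebesgue_integral_def
      by (subst Bochner_Integration.integral_minus[symmetric])
         (auto intro!: Bochner_Integration.integral_cong simp: f_def algebra_simps)
    finally have "?c * (\<integral>z. indicator A z * f z \<partial>lborel) \<le> - (LINT z:{z. norm z > \<epsilon>}|\<mu>. u (x + z) - u x)" .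
    moreover have "?c * (?V * u x - ?I) \<le> ?c * (\<integral>z. indicator A z * f z \<partial>lborel)"
      using lb C1 by (intro mult_left_mono) auto
    ultimately show ?thesis by linarith
  qed
  have "((\<lambda>\<epsilon>. LINT z:{z. norm z > \<epsilon>}|\<mu>. u (x + z) - u x) \<longlongrightarrow> levy_op \<mu> u x) (at_right 0)"
    by (rule levy_op_of_second_difference_bound(1)[OF \<mu> um ub L])
  then show ?thesis
    by (rule tendsto_upperbound)
       (use ineq r in \<open>auto simp: eventually_at_right_field intro!: exI[of _ "r / 2"]\<close>)
qed

section \<open>The maximum principle\<close>

lemma continuous_vanishing_attains_sup:
  fixes u :: "'a::euclidean_space \<Rightarrow> real"
  assumes u: "continuous_on UNIV u" "\<And>x. 0 \<le> u x"
    and van: "\<And>e. e > 0 \<Longrightarrow> \<exists>R. \<forall>x. norm x > R \<longrightarrow> \<bar>u x\<bar> < e"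
  obtains x where "\<And>y. u y \<le> u x"
proof (cases "\<exists>y. u y > 0")
  case False
  then have "u y \<le> u 0" for y using u(2)[of 0] by (meson linorder_not_less order_trans)
  then show ?thesis by (rule that)
next
  case True
  then obtain y where y: "u y > 0" by blast
  obtain R where R: "\<And>x. norm x > R \<Longrightarrow> \<bar>u x\<bar> < u y" using van[OF y] by blast
  let ?S = "cball (0::'a) (max R (norm y))"
  have "y \<in> ?S" by simp
  then obtain x where x: "x \<in> ?S" "\<And>z. z \<in> ?S \<Longrightarrow> u z \<le> u x"
    using continuous_attains_sup[of ?S u] u(1) continuous_on_subset compact_cball
    by (metis empty_iff subset_UNIV)
  have "u z \<le> u x" for z
  proof (cases "z \<in> ?S")
    case False
    then have "norm z > R" by (auto simp: not_le)
    then have "u z \<le> u y" using R[of z] by linarith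
    also have "u y \<le> u x" using x(2) \<open>y \<in> ?S\<close> .
    finally show ?thesis .
  qed (use x in auto)
  then show ?thesis by (rule that)
qed

text \<open>
  The kernel of an operator whose measure dominates \<open>C1 |z| powr (- d - \<alpha>) dz\<close> on the unit ball,
  where \<open>d\<close> is the dimension. The parameter \<open>q\<close> abbreviates the decay exponent \<open>d / \<alpha>\<close>.
\<close>

locale stable_like_heat_kernel =
  fixes \<mu> :: "'a::euclidean_space measure" and H :: "'a \<Rightarrow> real \<Rightarrow> real" and \<alpha> C1 q :: real
  assumes q_eq: "q = real DIM('a) / \<alpha>" and alpha_pos: "\<alpha> > 0" and C1_pos: "C1 > 0"
    and radon: "radon_punctured \<mu>" and symmetric: "symmetric_measure \<mu>"
    and levy: "levy_integrable \<mu>"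
    and ac: "absolutely_continuous lborel_punctured \<mu>"
    and near: "AE z in lborel_punctured. norm z \<le> 1 \<longrightarrow>
        ennreal (C1 / norm z powr (real DIM('a) + \<alpha>)) \<le> RN_deriv lborel_punctured \<mu> z"
    and kernel: "heat_kernel \<mu> H"
begin

abbreviation sol :: "('a \<Rightarrow> real) \<Rightarrow> 'a \<Rightarrow> real \<Rightarrow> real" where
  "sol f x t \<equiv> conv (\<lambda>x. H x t) f x"

lemma q_pos: "q > 0" using alpha_pos by (simp add: q_eq)

lemma sub_density_H: "t > 0 \<Longrightarrow> sub_density (\<lambda>x. H x t)"
  using kernel by (auto simp: heat_kernel_def sub_density_def)

lemma heat_equation:
  assumes "test_fun f" "t > 0"
  shows "((\<lambda>s. sol f x s) has_real_derivative levy_op \<mu> (\<lambda>y. sol f y t) x) (at t)"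
  using kernel assms unfolding heat_kernel_def solves_heat_eq_def conv_def by blast

lemma sol_time_lipschitz:
  assumes f: "test_fun f"
  obtains K where "K \<ge> 0" "\<And>x s t. 0 < s \<Longrightarrow> s \<le> t \<Longrightarrow> \<bar>sol f x t - sol f x s\<bar> \<le> K * (t - s)"
proof -
  obtain M where M: "M \<ge> 0" "\<And>x. \<bar>f x\<bar> \<le> M" using test_fun_bounded[OF f] by blast
  obtain L where L: "L \<ge> 0" "\<And>x z. \<bar>f (x + z) + f (x - z) - 2 * f x\<bar> \<le> L * (norm z)\<^sup>2"
    using test_fun_second_difference[OF f] by blast
  let ?K = "(L + 4 * M) * (\<integral>z. min 1 ((norm z)\<^sup>2) \<partial>\<mu>)"
  have bound: "\<bar>levy_op \<mu> (\<lambda>y. sol f y t) x\<bar> \<le> ?K" if "t > 0" for t x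
  proof (rule levy_op_of_second_difference_bound(2)[OF radon symmetric levy])
    note h = sub_density_H[OF that]
    show "(\<lambda>y. sol f y t) \<in> borel_measurable borel"
      by (intro borel_measurable_continuous_onI conv_continuous h f)
    show "\<bar>sol f x t\<bar> \<le> M" for x by (rule abs_conv_le[OF h test_fun_measurable[OF f] M(2)])
    show "\<bar>sol f (x + z) t + sol f (x - z) t - 2 * sol f x t\<bar> \<le> L * (norm z)\<^sup>2" for z
      by (rule conv_second_difference[OF h f L(2)])
  qed
  have K0: "?K \<ge> 0" using M(1) L(1) by (intro mult_nonneg_nonneg integral_nonneg_AE) auto
  have "\<bar>sol f x t - sol f x s\<bar> \<le> ?K * (t - s)" if st: "0 < s" "s \<le> t" for x s t
  proof (cases "s = t")
    case False
    then obtain r where r: "s < r" "r < t"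
      "sol f x t - sol f x s = (t - s) * levy_op \<mu> (\<lambda>y. sol f y r) x"
      using MVT2[of s t "sol f x" "\<lambda>r. levy_op \<mu> (\<lambda>y. sol f y r) x"] st heat_equation[OF f]
      by auto
    have "\<bar>sol f x t - sol f x s\<bar> = (t - s) * \<bar>levy_op \<mu> (\<lambda>y. sol f y r) x\<bar>"
      using r st by (simp add: abs_mult)
    also have "\<dots> \<le> (t - s) * ?K" using bound[of r x] r st by (intro mult_left_mono) auto
    finally show ?thesis by (simp add: mult.commute)
  qed simp
  with K0 show ?thesis by (rule that)
qed

text \<open>
  The estimate at a maximum with the annulus of radius \<open>r\<close>, where \<open>r powr \<alpha> = k t\<close>: the radius
  adapted to the natural scaling of the equation.
\<close>

lemma levy_op_sol_le_at_max:
  assumes f: "test_fun f" "\<And>x. 0 \<le> f x" and m: "(\<integral>x. f x \<partial>lborel) \<le> m"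
    and t: "t > 0" and k: "k > 0" "k * t \<le> 1" and max: "\<And>y. sol f y t \<le> sol f x t"
  shows "levy_op \<mu> (\<lambda>y. sol f y t) x \<le>
    - (C1 / (k * t) * (unit_ball_vol DIM('a) / 2 * sol f x t - m * (k * t) powr - q))"
proof -
  note h = sub_density_H[OF t]
  define r where "r = (k * t) powr (1 / \<alpha>)"
  have kt: "k * t > 0" using k t by simp
  then have r: "0 < r" "r \<le> 1" using k alpha_pos by (auto simp: r_def intro!: powr_le1)
  have rd: "r ^ DIM('a) = (k * t) powr q"
    using r by (simp add: powr_realpow[symmetric] r_def powr_powr q_eq)
  have rda: "r powr (real DIM('a) + \<alpha>) = (k * t) powr q * (k * t)"
    using kt alpha_pos by (simp add: powr_add r_def powr_powr q_eq)
  obtain L where L: "L \<ge> 0" "\<And>x z. \<bar>f (x + z) + f (x - z) - 2 * f x\<bar> \<le> L * (norm z)\<^sup>2"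
    using test_fun_second_difference[OF f(1)] by blast
  let ?I = "\<integral>y. sol f y t \<partial>lborel" and ?V = "unit_ball_vol DIM('a)"
  have "levy_op \<mu> (\<lambda>y. sol f y t) x \<le>
    - (C1 / r powr (real DIM('a) + \<alpha>) * (?V / 2 * r ^ DIM('a) * sol f x t - ?I))"
  proof (rule levy_op_le_at_max[OF radon symmetric levy ac near])
    show "integrable lborel (\<lambda>y. sol f y t)" by (rule conv_integral_le(1)[OF h f])
    show "0 \<le> sol f x t" for x by (rule conv_nonneg[OF h f(2)])
    show "\<bar>sol f (x + z) t + sol f (x - z) t - 2 * sol f x t\<bar> \<le> L * (norm z)\<^sup>2" for z
      by (rule conv_second_difference[OF h f(1) L(2)])
  qed (use r max alpha_pos C1_pos in auto)
  also have "\<dots> \<le> - (C1 / r powr (real DIM('a) + \<alpha>) * (?V / 2 * r ^ DIM('a) * sol f x t - m))"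
    using conv_integral_le(2)[OF h f] m C1_pos
    by (intro le_imp_neg_le mult_left_mono) auto
  also have "C1 / r powr (real DIM('a) + \<alpha>) * (?V / 2 * r ^ DIM('a) * sol f x t - m)
      = C1 / (k * t) * (?V / 2 * sol f x t - m * (k * t) powr - q)"
    unfolding rd rda using kt k t by (simp add: powr_minus field_simps)
  finally show ?thesis .
qed

text \<open>
  The maximum principle. The barrier \<open>B m t\<^sup>-\<^sup>q\<close> exceeds the solution for small \<open>t\<close>. At the first
  time \<open>ts\<close> at which it is touched, at a maximum point \<open>xs\<close>, the solution minus the barrier would
  have nonnegative time derivative; but with the constants below the equation makes it negative.
\<close>

lemma sol_le_power:
  obtains B T where "B > 0" "T > 0"
    "\<And>f m t x. test_fun f \<Longrightarrow> (\<And>x. 0 \<le> f x) \<Longrightarrow> (\<integral>x. f x \<partial>lborel) \<le> m \<Longrightarrow> m > 0 \<Longrightarrow>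
       0 < t \<Longrightarrow> t \<le> T \<Longrightarrow> sol f x t \<le> B * m * t powr - q"
proof -
  define V where "V = unit_ball_vol (real DIM('a))"
  have V: "V > 0" by (simp add: V_def)
  \<comment> \<open>The rate \<open>k\<close> makes the coefficient of \<open>B\<close> in the decay of the solution exceed, by \<open>1\<close>, the
    coefficient \<open>q\<close> in the decay of the barrier; then \<open>B\<close> absorbs the remaining term.\<close>
  define k where "k = C1 * V / (2 * (q + 1))"
  have k: "k > 0" using C1_pos V q_pos by (simp add: k_def add_pos_pos)
  have kV: "C1 / k * (V / 2) = q + 1" using C1_pos V q_pos k unfolding k_def
    by (simp add: field_simps)
  define B where "B = C1 / k * k powr - q + 1"
  have B: "B > 0" using C1_pos k by (simp add: B_def add_nonneg_pos)
  have main: "sol f x0 t0 \<le> B * m * t0 powr - q"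
    if f: "test_fun f" "\<And>x. 0 \<le> f x" and m: "(\<integral>x. f x \<partial>lborel) \<le> m" "m > 0"
      and t0: "0 < t0" "t0 \<le> 1 / k" for f m t0 x0
  proof (rule ccontr)
    define b where "b t = B * m * t powr - q" for t
    define S where "S = {t. 0 < t \<and> t \<le> 1 / k \<and> (\<exists>x. b t \<le> sol f x t)}"
    define ts where "ts = Inf S"
    assume "\<not> sol f x0 t0 \<le> B * m * t0 powr - q"
    then have t0S: "t0 \<in> S" using t0 by (auto simp: S_def b_def intro!: exI[of _ x0])
    have Bm: "B * m > 0" using B m by simp
    obtain M where M: "M \<ge> 0" "\<And>x. \<bar>f x\<bar> \<le> M" using test_fun_bounded[OF f(1)] by blast
    \<comment> \<open>Before time \<open>\<delta>\<close> the barrier is above the bound \<open>M\<close> for the initial datum.\<close>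
    define \<delta> where "\<delta> = (B * m / (M + 1)) powr (1 / q)"
    have \<delta>: "\<delta> > 0" using B m M by (simp add: \<delta>_def)
    have S_ge: "\<delta> \<le> t" if tS: "t \<in> S" for t
    proof (rule ccontr)
      assume "\<not> \<delta> \<le> t"
      with tS have t: "0 < t" "t < \<delta>" by (auto simp: S_def)
      have "t powr q < \<delta> powr q" using t q_pos by (intro powr_less_mono2) auto
      also have "\<dots> = B * m / (M + 1)"
        using q_pos Bm M unfolding \<delta>_def powr_powr by simp
      finally have "M + 1 < b t"
        using t M Bm by (simp add: b_def powr_minus field_simps)
      moreover have "sol f x t \<le> M" for x
        using abs_conv_le[OF sub_density_H[OF t(1)] test_fun_measurable[OF f(1)] M(2), of x] by simp
      moreover obtain x where "b t \<le> sol f x t" using tS by (auto simp: S_def)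
      ultimately show False by (smt (verit))
    qed
    have bdd: "bdd_below S" using S_ge by (rule bdd_belowI)
    have ts: "0 < ts" "ts \<le> 1 / k"
    proof -
      have "\<delta> \<le> ts" unfolding ts_def using t0S S_ge by (intro cInf_greatest) auto
      then show "0 < ts" using \<delta> by simp
      show "ts \<le> 1 / k" unfolding ts_def using cInf_lower[OF t0S bdd] t0 by simp
    qed
    have before: "sol f x t < b t" if "0 < t" "t < ts" for x t
    proof (rule ccontr)
      assume "\<not> sol f x t < b t"
      then have "t \<in> S" using that ts by (auto simp: S_def not_less)
      then show False using cInf_lower[OF _ bdd, of t] that by (simp add: ts_def)
    qed
    obtain xs where max: "\<And>y. sol f y ts \<le> sol f xs ts"
    proof (rule continuous_vanishing_attains_sup[of "\<lambda>y. sol f y ts"])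
      note h = sub_density_H[OF ts(1)]
      show "continuous_on UNIV (\<lambda>y. sol f y ts)" by (rule conv_continuous[OF h f(1)])
      show "0 \<le> sol f x ts" for x by (rule conv_nonneg[OF h f(2)])
      show "\<exists>R. \<forall>x. norm x > R \<longrightarrow> \<bar>sol f x ts\<bar> < e" if "e > 0" for e
        using conv_vanishes_at_infinity[OF h f(1) that] by metis
    qed blast
    \<comment> \<open>A gap at time \<open>ts\<close> would persist for a while at all points simultaneously, because the
      solution is Lipschitz in time uniformly in space.\<close>
    have touch: "b ts \<le> sol f xs ts"
    proof (rule ccontr)
      assume less: "\<not> b ts \<le> sol f xs ts"
      define g where "g = b ts - sol f xs ts"
      have g: "g > 0" using less by (simp add: g_def)
      obtain K where K: "K \<ge> 0"
        "\<And>x s t. 0 < s \<Longrightarrow> s \<le> t \<Longrightarrow> \<bar>sol f x t - sol f x s\<bar> \<le> K * (t - s)"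
        using sol_time_lipschitz[OF f(1)] by blast
      have "isCont (\<lambda>t. b t - K * (t - ts)) ts"
        unfolding b_def using ts by (intro continuous_intros) auto
      then have "((\<lambda>t. b t - K * (t - ts)) \<longlongrightarrow> b ts) (at ts)"
        unfolding isCont_def by simp
      then have "\<forall>\<^sub>F t in at ts. sol f xs ts < b t - K * (t - ts)"
        using less by (intro order_tendstoD(1)) auto
      then obtain \<eta> where \<eta>: "\<eta> > 0"
        "\<And>t. t \<noteq> ts \<Longrightarrow> \<bar>t - ts\<bar> < \<eta> \<Longrightarrow> sol f xs ts < b t - K * (t - ts)"
        unfolding eventually_at by (auto simp: dist_real_def)
      obtain t where t: "t \<in> S" "t < ts + \<eta>"
        using cInf_lessD[of S "ts + \<eta>"] t0S \<eta>(1) by (auto simp: ts_def)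
      have "ts \<le> t" using cInf_lower[OF t(1) bdd] by (simp add: ts_def)
      then have "sol f xs ts < b t - K * (t - ts)"
        using \<eta>(2)[of t] t(2) less by (cases "t = ts") auto
      moreover have "sol f y t \<le> sol f xs ts + K * (t - ts)" for y
        using K(2)[OF ts(1) \<open>ts \<le> t\<close>, of y] max[of y] by linarith
      ultimately have "sol f y t < b t" for y by (smt (verit))
      with t(1) show False by (auto simp: S_def not_le[symmetric])
    qed
    let ?D = "levy_op \<mu> (\<lambda>y. sol f y ts) xs"
    have "((\<lambda>t. sol f xs t - b t) has_real_derivative ?D - B * m * (- q * ts powr (- q - 1))) (at ts)"
      unfolding b_def using ts
      by (intro derivative_intros heat_equation f DERIV_cmult has_real_derivative_powr) auto
    moreover have "?D - B * m * (- q * ts powr (- q - 1)) < 0"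
    proof -
      have "?D \<le> - (C1 / (k * ts) * (V / 2 * sol f xs ts - m * (k * ts) powr - q))"
        unfolding V_def
        by (rule levy_op_sol_le_at_max[OF f m(1) ts(1) k _ max]) (use ts k in \<open>simp add: field_simps\<close>)
      also have "\<dots> \<le> - (C1 / (k * ts) * (V / 2 * b ts - m * (k * ts) powr - q))"
        using touch V C1_pos k ts by (intro le_imp_neg_le mult_left_mono diff_right_mono) auto
      also have "C1 / (k * ts) * (V / 2 * b ts - m * (k * ts) powr - q)
          = m * ts powr - q / ts * (C1 / k * (V / 2) * B - C1 / k * k powr - q)"
        using k ts by (simp add: b_def powr_mult field_simps)
      also have "C1 / k * (V / 2) * B - C1 / k * k powr - q = q * B + 1"
        unfolding kV by (simp add: B_def algebra_simps add_divide_distrib)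
      finally have "?D \<le> - (m * ts powr - q / ts * (q * B + 1))" .
      also have "m * ts powr - q / ts = m * ts powr (- q - 1)"
        using ts by (simp add: powr_diff)
      finally have "?D - B * m * (- q * ts powr (- q - 1)) \<le> - (m * ts powr (- q - 1))"
        by (simp add: algebra_simps)
      also have "\<dots> < 0" using m ts by simp
      finally show ?thesis .
    qed
    ultimately obtain d where d: "d > 0"
      "\<And>h. 0 < h \<Longrightarrow> h < d \<Longrightarrow> sol f xs ts - b ts < sol f xs (ts - h) - b (ts - h)"
      using DERIV_neg_dec_left by blast
    define h where "h = min (d / 2) (ts / 2)"
    have h: "0 < h" "h < d" "0 < ts - h" "ts - h < ts" using d(1) ts by (auto simp: h_def)
    show False using d(2)[OF h(1,2)] before[OF h(3,4), of xs] touch by linarith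
  qed
  show ?thesis by (rule that[OF B _ main]) (use k in auto)
qed

end

section \<open>The pointwise bound on the heat kernel\<close>

text \<open>
  A bound against nonnegative test functions passes to indicators of open sets by dominated
  convergence, then to the set where \<open>g > b\<close> by outer regularity, and so forces that set to be null.
\<close>

lemma AE_le_of_test_fun:
  fixes g :: "'a::euclidean_space \<Rightarrow> real"
  assumes g: "integrable lborel g" "\<And>y. 0 \<le> g y" and b: "b > 0"
    and test: "\<And>f m. test_fun f \<Longrightarrow> (\<And>x. 0 \<le> f x) \<Longrightarrow> (\<integral>x. f x \<partial>lborel) \<le> m \<Longrightarrow> m > 0 \<Longrightarrow>
      (\<integral>y. g y * f y \<partial>lborel) \<le> b * m"
  shows "AE y in lborel. g y \<le> b"
proof -
  have [measurable]: "g \<in> borel_measurable borel" using g(1) by auto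
  have ind: "integrable lborel (\<lambda>y. g y * indicator A y)" if [measurable]: "A \<in> sets borel" for A
    by (rule Bochner_Integration.integrable_bound[OF g(1)]) (auto simp: indicator_def)
  have open_le: "(\<integral>y. g y * indicator U y \<partial>lborel) \<le> b * m"
    if U: "open U" "emeasure lborel U \<le> ennreal m" and m: "m > 0" for U m
  proof -
    have [measurable]: "U \<in> sets borel" using U(1) by simp
    obtain \<phi> :: "nat \<Rightarrow> 'a \<Rightarrow> real" where \<phi>:
      "\<And>n. test_fun (\<phi> n)" "\<And>n x. 0 \<le> \<phi> n x" "\<And>n x. \<phi> n x \<le> indicator U x"
      "\<And>x. (\<lambda>n. \<phi> n x) \<longlonglongrightarrow> indicator U x"
      using test_fun_tendsto_indicator_open[OF U(1)] by blast
    note [measurable] = test_fun_measurable[OF \<phi>(1)]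
    have "(\<integral>x. \<phi> n x \<partial>lborel) \<le> m" for n
    proof -
      have fin: "emeasure lborel U < \<infinity>" using U(2) by (rule le_less_trans) simp
      have "(\<integral>x. \<phi> n x \<partial>lborel) \<le> (\<integral>x. indicator U x \<partial>lborel)"
        using fin by (intro integral_mono test_fun_integrable \<phi> integrable_real_indicator) auto
      also have "\<dots> \<le> m" using U(2) m by (simp add: measure_def enn2real_leI)
      finally show ?thesis .
    qed
    then have le: "(\<integral>y. g y * \<phi> n y \<partial>lborel) \<le> b * m" for n
      using test[OF \<phi>(1,2)] m by blast
    have "(\<lambda>n. \<integral>y. g y * \<phi> n y \<partial>lborel) \<longlonglongrightarrow> (\<integral>y. g y * indicator U y \<partial>lborel)"
    proof (rule integral_dominated_convergence)
      show "AE y in lborel. norm (g y * \<phi> n y) \<le> g y" for n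
      proof (intro AE_I2)
        fix y
        have "\<phi> n y \<le> 1" using \<phi>(3)[of n y] by (cases "y \<in> U") auto
        then show "norm (g y * \<phi> n y) \<le> g y"
          using g(2)[of y] \<phi>(2)[of n y] by (simp add: abs_mult mult_left_le)
      qed
    qed (use g \<phi>(4) in \<open>auto intro!: tendsto_mult_left\<close>)
    then show ?thesis by (rule LIMSEQ_le_const2) (use le in auto)
  qed
  define S where "S = {y. b < g y}"
  have [measurable]: "S \<in> sets borel" unfolding S_def by measurable
  have iS: "integrable lborel (\<lambda>y. indicator S y :: real)"
  proof (rule Bochner_Integration.integrable_bound)
    show "integrable lborel (\<lambda>y. g y / b)" using g(1) by simp
    show "AE y in lborel. norm (indicator S y :: real) \<le> norm (g y / b)"
      using b by (auto simp: S_def indicator_def field_simps)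
  qed simp
  then have finS: "emeasure lborel S < \<infinity>" by (simp add: integrable_indicator_iff)
  have "(\<integral>y. g y * indicator S y \<partial>lborel) \<le> b * measure lborel S + e" if "e > 0" for e
  proof -
    define d where "d = e / b"
    have d: "d > 0" using that b by (simp add: d_def)
    have "S \<in> sets borel" by measurable
    from outer_regular_lborel[OF this d] obtain U where
      U: "open U" "S \<subseteq> U" "emeasure lborel (U - S) < ennreal d" by blast
    have [measurable]: "U \<in> sets borel" using U(1) by simp
    have "emeasure lborel U = emeasure lborel (S \<union> (U - S))" using U(2) by (simp add: Un_absorb1)
    also have "\<dots> \<le> emeasure lborel S + emeasure lborel (U - S)"
      by (rule emeasure_subadditive) auto
    also have "\<dots> \<le> ennreal (measure lborel S) + ennreal d"
      using U(3) finS by (intro add_mono) (auto simp: emeasure_eq_ennreal_measure less_top)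
    also have "\<dots> = ennreal (measure lborel S + d)" using d by simp
    finally have "(\<integral>y. g y * indicator U y \<partial>lborel) \<le> b * (measure lborel S + d)"
      using d by (intro open_le U) (auto intro: add_nonneg_pos)
    moreover have "(\<integral>y. g y * indicator S y \<partial>lborel) \<le> (\<integral>y. g y * indicator U y \<partial>lborel)"
      using g(2) U(2) by (intro integral_mono ind) (auto simp: indicator_def)
    ultimately show ?thesis using b by (simp add: d_def distrib_left)
  qed
  then have le: "(\<integral>y. g y * indicator S y \<partial>lborel) \<le> b * measure lborel S"
    by (rule field_le_epsilon)
  let ?d = "\<lambda>y. g y * indicator S y - b * indicator S y"
  have id: "integrable lborel ?d" using iS by (intro Bochner_Integration.integrable_diff ind) auto
  have d0: "0 \<le> ?d y" for y by (auto simp: S_def indicator_def)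
  have "(\<integral>y. ?d y \<partial>lborel) = (\<integral>y. g y * indicator S y \<partial>lborel) - b * measure lborel S"
    using iS by (subst Bochner_Integration.integral_diff) (auto intro!: ind)
  then have "(\<integral>y. ?d y \<partial>lborel) = 0"
    using le integral_nonneg_AE[of ?d lborel] d0 by (simp add: antisym)
  then have "AE y in lborel. ?d y = 0"
    using integral_nonneg_eq_0_iff_AE[OF id] d0 by simp
  then show ?thesis
    by eventually_elim (auto simp: S_def indicator_def split: if_splits)
qed

context stable_like_heat_kernel
begin

text \<open>
  The semigroup identity holds at every point, and therefore turns an almost everywhere bound at time
  \<open>s\<close> into a bound at every point at all strictly later times.
\<close>

lemma chapman_kolmogorov_le:
  assumes "s > 0" "t > 0" "b \<ge> 0" and le: "AE y in lborel. H (x - y) s \<le> b"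
  shows "H x (s + t) \<le> b"
proof -
  have h: "sub_density (\<lambda>x. H x s)" "sub_density (\<lambda>x. H x t)"
    using sub_density_H assms by auto
  note [measurable] = h[THEN sub_density_measurable]
  have i: "integrable lborel (\<lambda>y. b * H y t)" using h(2) by (simp add: sub_density_def)
  have "H x (s + t) = (\<integral>y. H (x - y) s * H y t \<partial>lborel)"
    using kernel assms(1,2) by (auto simp: heat_kernel_def)
  also have "\<dots> \<le> (\<integral>y. b * H y t \<partial>lborel)"
  proof (rule integral_mono_AE)
    have H0: "H y t \<ge> 0" "H (x - y) s \<ge> 0" for y using h by (auto simp: sub_density_def)
    show le': "AE y in lborel. H (x - y) s * H y t \<le> b * H y t"
      using le by eventually_elim (auto intro: mult_right_mono H0)
    show "integrable lborel (\<lambda>y. H (x - y) s * H y t)"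
      by (rule Bochner_Integration.integrable_bound[OF i])
         (use le' H0 \<open>b \<ge> 0\<close> in \<open>auto elim!: eventually_mono\<close>)
  qed (rule i)
  also have "\<dots> = b * (\<integral>y. H y t \<partial>lborel)" by simp
  also have "\<dots> \<le> b * 1" using h(2) \<open>b \<ge> 0\<close> by (intro mult_left_mono) (auto simp: sub_density_def)
  finally show ?thesis by simp
qed

text \<open>
  For large times the bound is propagated by the contraction property, and the factor \<open>exp t\<close>
  compensates for the decay of \<open>t powr - q\<close>.
\<close>

lemma heat_kernel_le:
  obtains C where "C > 0" "\<And>x t. t > 0 \<Longrightarrow> H x t \<le> C * t powr - q * exp t"
proof -
  obtain B T where BT: "B > 0" "T > 0"
    "\<And>f m t x. test_fun f \<Longrightarrow> (\<And>x. 0 \<le> f x) \<Longrightarrow> (\<integral>x. f x \<partial>lborel) \<le> m \<Longrightarrow> m > 0 \<Longrightarrow>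
       0 < t \<Longrightarrow> t \<le> T \<Longrightarrow> sol f x t \<le> B * m * t powr - q"
    using sol_le_power by blast
  have AE_le: "AE y in lborel. H (x - y) t \<le> B * t powr - q" if t: "0 < t" "t \<le> T" for x t
  proof (rule AE_le_of_test_fun)
    have h: "sub_density (\<lambda>x. H x t)" by (rule sub_density_H[OF t(1)])
    then show "integrable lborel (\<lambda>y. H (x - y) t)"
      using lborel_integrable_minus by (auto simp: sub_density_def)
    show "0 \<le> H (x - y) t" for y using h by (simp add: sub_density_def)
    show "0 < B * t powr - q" using BT t by simp
    show "(\<integral>y. H (x - y) t * f y \<partial>lborel) \<le> B * t powr - q * m"
      if "test_fun f" "\<And>x. 0 \<le> f x" "(\<integral>x. f x \<partial>lborel) \<le> m" "m > 0" for f m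
      using BT(3)[OF that t, of x] by (simp add: conv_def mult_ac)
  qed
  define A where "A = B * 2 powr q"
  have A: "A > 0" using BT by (simp add: A_def)
  have small: "H x t \<le> A * t powr - q" if "0 < t" "t \<le> T" for x t
  proof -
    have "H x (t / 2 + t / 2) \<le> B * (t / 2) powr - q"
      using that BT by (intro chapman_kolmogorov_le AE_le) auto
    also have "\<dots> = A * t powr - q"
      using that by (simp add: A_def powr_divide powr_minus field_simps)
    finally show ?thesis by simp
  qed
  have large: "H x t \<le> A * T powr - q" if "t > T" for x t
  proof -
    have "H x (T + (t - T)) \<le> A * T powr - q"
      using that BT A small by (intro chapman_kolmogorov_le) auto
    then show ?thesis by simp
  qed
  define C where "C = A + A * T powr - q * q powr q"
  have C: "C > 0" using A BT by (simp add: C_def add_pos_nonneg)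
  have "H x t \<le> C * t powr - q * exp t" if t: "t > 0" for x t
  proof (cases "t \<le> T")
    case True
    have "H x t \<le> A * t powr - q * 1" using small[OF t True] by simp
    also have "\<dots> \<le> C * t powr - q * exp t"
      using A t by (intro mult_mono) (auto simp: C_def)
    finally show ?thesis .
  next
    case False
    have "t / q \<le> exp (t / q)" using exp_ge_add_one_self[of "t / q"] by linarith
    then have "(t / q) powr q \<le> exp (t / q) powr q" using t q_pos by (intro powr_mono2) auto
    then have "t powr q \<le> q powr q * exp t"
      using t q_pos by (simp add: powr_divide exp_powr_real field_simps)
    then have "1 \<le> q powr q * t powr - q * exp t"
      using t by (simp add: powr_minus field_simps)
    then have "A * T powr - q * 1 \<le> A * T powr - q * (q powr q * t powr - q * exp t)"
      using A by (intro mult_left_mono) auto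
    also have "\<dots> = (A * T powr - q * q powr q) * (t powr - q * exp t)" by simp
    also have "\<dots> \<le> C * (t powr - q * exp t)"
      using A by (intro mult_right_mono) (auto simp: C_def)
    finally show ?thesis using large[of t x] False by (simp add: mult.assoc)
  qed
  with C show ?thesis by (rule that)
qed

end

section \<open>Integrability of the Green function\<close>

lemma epowr_measurable[measurable]: "(\<lambda>a. epowr a p) \<in> borel_measurable borel"
  unfolding epowr_def by measurable

lemma epowr_ennreal: "a \<ge> 0 \<Longrightarrow> epowr (ennreal a) p = ennreal (a powr p)"
  by (simp add: epowr_def)

text \<open>
  Jensen's inequality for \<open>s \<mapsto> s\<^sup>p\<close> and measures of mass at most \<open>1\<close>; either integral may
  be infinite. It results from integrating Young's inequality
  \<open>m\<^sup>p\<^sup>-\<^sup>1 s \<le> s\<^sup>p/p + (1 - 1/p) m\<^sup>p\<close>, with \<open>m\<close> the left-hand integral.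
\<close>

lemma epowr_nn_integral_le:
  assumes M: "emeasure M (space M) \<le> 1" and p: "p > 1"
    and g: "g \<in> borel_measurable M" "\<And>t. 0 \<le> g t"
  shows "epowr (\<integral>\<^sup>+t. ennreal (g t) \<partial>M) p \<le> (\<integral>\<^sup>+t. ennreal (g t powr p) \<partial>M)"
proof (cases "(\<integral>\<^sup>+t. ennreal (g t powr p) \<partial>M) = \<infinity>")
  case False
  note [measurable] = g(1)
  let ?G = "\<integral>\<^sup>+t. ennreal (g t) \<partial>M" and ?J = "\<integral>\<^sup>+t. ennreal (g t powr p) \<partial>M"
  have young: "m powr (p - 1) * s \<le> s powr p / p + (1 - 1 / p) * m powr p"
    if "m > 0" "s \<ge> 0" for m s :: real
  proof (cases "s = 0")
    case True
    then show ?thesis using p that by (auto intro!: mult_nonneg_nonneg simp: field_simps)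
  next
    case False
    have "(s powr p) powr (1 / p) * (m powr p) powr (1 - 1 / p) \<le> 1 / p * s powr p + (1 - 1 / p) * m powr p"
      using that False p by (intro Youngs_inequality_0) auto
    moreover have "p * (1 - 1 / p) = p - 1" using p by (simp add: field_simps)
    ultimately show ?thesis using that False p by (simp add: powr_powr mult.commute)
  qed
  have "?G \<le> (\<integral>\<^sup>+t. ennreal (g t powr p) + 1 \<partial>M)"
  proof (intro nn_integral_mono)
    fix t
    have "g t \<le> g t powr p + 1"
    proof (cases "g t \<le> 1")
      case False
      then have "g t powr 1 \<le> g t powr p" using p by (intro powr_mono) auto
      then show ?thesis using False by simp
    qed (auto intro: add_increasing)
    then have "ennreal (g t) \<le> ennreal (g t powr p + 1)" by (rule ennreal_leI)
    then show "ennreal (g t) \<le> ennreal (g t powr p) + 1" by simp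
  qed
  also have "\<dots> = ?J + emeasure M (space M)" by (subst nn_integral_add) auto
  also have "\<dots> < \<infinity>" using False M by (auto simp: less_top[symmetric] top_unique)
  finally have Gfin: "?G < \<infinity>" .
  define m where "m = enn2real ?G"
  define j where "j = enn2real ?J"
  have m: "?G = ennreal m" "m \<ge> 0" using Gfin by (auto simp: m_def)
  have j: "?J = ennreal j" "j \<ge> 0" using False by (auto simp: j_def less_top)
  show ?thesis
  proof (cases "m = 0")
    case True
    then show ?thesis using m p by (simp add: epowr_def)
  next
    case False
    with m have mp: "m > 0" by simp
    have c: "0 \<le> (1 - 1 / p) * m powr p" using p by simp
    have "ennreal (m powr p) = ennreal (m powr (p - 1)) * ?G"
      using mp by (simp add: m(1) ennreal_mult[symmetric] powr_diff)
    also have "\<dots> = (\<integral>\<^sup>+t. ennreal (m powr (p - 1) * g t) \<partial>M)"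
      by (simp add: nn_integral_cmult[symmetric] ennreal_mult' g(2))
    also have "\<dots> \<le> (\<integral>\<^sup>+t. ennreal (1 / p) * ennreal (g t powr p) + ennreal ((1 - 1 / p) * m powr p) \<partial>M)"
    proof (intro nn_integral_mono)
      fix t
      have "ennreal (m powr (p - 1) * g t) \<le> ennreal (1 / p * g t powr p + (1 - 1 / p) * m powr p)"
        using young[OF mp g(2)] by (intro ennreal_leI) simp
      also have "\<dots> = ennreal (1 / p) * ennreal (g t powr p) + ennreal ((1 - 1 / p) * m powr p)"
        using p c by (simp add: ennreal_mult[symmetric] del: ennreal_plus)
           (simp flip: ennreal_plus)
      finally show "ennreal (m powr (p - 1) * g t)
        \<le> ennreal (1 / p) * ennreal (g t powr p) + ennreal ((1 - 1 / p) * m powr p)" .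
    qed
    also have "\<dots> = ennreal (1 / p) * ?J + ennreal ((1 - 1 / p) * m powr p) * emeasure M (space M)"
      by (subst nn_integral_add) (auto simp: nn_integral_cmult)
    also have "\<dots> \<le> ennreal (1 / p) * ?J + ennreal ((1 - 1 / p) * m powr p) * 1"
      by (intro add_left_mono mult_left_mono M) simp
    also have "\<dots> = ennreal (1 / p * j + (1 - 1 / p) * m powr p)"
      using p c j by (simp add: ennreal_mult[symmetric])
    finally have "m powr p \<le> 1 / p * j + (1 - 1 / p) * m powr p"
      using p c j by (subst (asm) ennreal_le_iff) auto
    then have "m powr p \<le> j" using p by (simp add: field_simps)
    then show ?thesis using j by (simp add: m(1) mp less_imp_le epowr_ennreal ennreal_leI)
  qed
qed simp

lemma nn_integral_exp_weight_le_1: "(\<integral>\<^sup>+t. ennreal (exp (- t)) * indicator {0<..} (t::real) \<partial>lborel) \<le> 1"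
proof -
  have "(\<integral>\<^sup>+t. ennreal (exp (- t)) * indicator {0<..} (t::real) \<partial>lborel)
      \<le> (\<integral>\<^sup>+t. ennreal (exp (- t)) * indicator {0..} (t::real) \<partial>lborel)"
    by (intro nn_integral_mono) (auto simp: indicator_def)
  also have "\<dots> = ennreal (0 - (- exp (- 0)))"
  proof (rule nn_integral_FTC_atLeast)
    show "((\<lambda>t::real. - exp (- t)) \<longlongrightarrow> 0) at_top"
      using tendsto_minus[OF filterlim_compose[OF exp_at_bot filterlim_uminus_at_bot_at_top]] by simp
  qed (auto intro!: derivative_eq_intros)
  finally show ?thesis by simp
qed

lemma nn_integral_inverse_sqrt_exp_finite:
  "(\<integral>\<^sup>+t. ennreal (t powr (- 1 / 2) * exp (- t / 2)) * indicator {0<..} (t::real) \<partial>lborel) < \<infinity>"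
proof -
  have "(\<lambda>t. complex_of_real t powr (1 / 2 - 1) / of_real (exp (1 / 2 * t))) absolutely_integrable_on {0<..}"
    by (rule absolutely_integrable_Gamma_integral) auto
  then have "(\<lambda>t. norm (complex_of_real t powr (1 / 2 - 1) / of_real (exp (1 / 2 * t)))) integrable_on {0<..}"
    by (simp add: absolutely_integrable_on_def)
  then have "(\<lambda>t::real. t powr (- 1 / 2) * exp (- t / 2)) integrable_on {0<..}"
    by (rule integrable_eq) (auto simp: norm_divide norm_powr_real_powr exp_minus field_simps)
  then obtain I where "((\<lambda>t::real. t powr (- 1 / 2) * exp (- t / 2)) has_integral I) {0<..}"
    by (auto simp: integrable_on_def)
  from nn_integral_has_integral_lebesgue'[OF _ this] show ?thesis by simp
qed

text \<open>
  The measure \<open>e\<^sup>-\<^sup>t dt\<close> on the positive half-line, against which the Green function averages the heat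
  kernel.
\<close>

definition exp_measure :: "real measure" where
  "exp_measure = density lborel (\<lambda>t. ennreal (exp (- t)) * indicator {0<..} t)"

lemma emeasure_exp_measure_le_1: "emeasure exp_measure (space exp_measure) \<le> 1"
  using nn_integral_exp_weight_le_1 by (simp add: exp_measure_def emeasure_density)

lemma green_translate: "green H x0 x = green H 0 (x - x0)"
  by (simp add: green_def heat_kernel_at_def)

context stable_like_heat_kernel
begin

lemma H_jointly_measurable:
  "(\<lambda>(x, t). indicator {0<..} t * H x t) \<in> borel_measurable (borel \<Otimes>\<^sub>M borel)"
proof -
  have "open (UNIV \<times> {0<..} :: ('a \<times> real) set)" by (intro open_Times) auto
  then have "(\<lambda>p. indicator (UNIV \<times> {0<..}) p *\<^sub>R (case p of (x, t) \<Rightarrow> H x t)) \<in> borel_measurable borel"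
    using kernel by (subst borel_measurable_restrict_space_iff[symmetric]) (auto simp: heat_kernel_def)
  also have "(\<lambda>p. indicator (UNIV \<times> {0<..}) p *\<^sub>R (case p of (x, t) \<Rightarrow> H x t))
      = (\<lambda>(x, t). indicator {0<..} t * H x t)"
    by (auto simp: fun_eq_iff indicator_def)
  finally show ?thesis by (simp add: borel_prod)
qed

lemma H_measurable_at: "(\<lambda>t. indicator {0<..} t * H x t) \<in> borel_measurable borel"
  using measurable_compose[OF measurable_Pair1' H_jointly_measurable, of x] by simp

lemma green_eq_exp_measure:
  "green H 0 x = (\<integral>\<^sup>+t. ennreal (indicator {0<..} t * H x t) \<partial>exp_measure)"
proof -
  note [measurable] = H_measurable_at
  have "(\<integral>\<^sup>+t. ennreal (indicator {0<..} t * H x t) \<partial>exp_measure)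
      = (\<integral>\<^sup>+t. ennreal (exp (- t)) * indicator {0<..} t * ennreal (indicator {0<..} t * H x t) \<partial>lborel)"
    unfolding exp_measure_def by (rule nn_integral_density) measurable
  also have "\<dots> = green H 0 x"
    unfolding green_def heat_kernel_at_def
    by (intro nn_integral_cong) (auto simp: indicator_def ennreal_mult')
  finally show ?thesis by simp
qed

lemma green_measurable: "green H 0 \<in> borel_measurable borel"
proof -
  note [measurable] = H_jointly_measurable
  interpret finite_measure exp_measure
    by (rule finite_measureI) (use emeasure_exp_measure_le_1 in \<open>auto simp: top_unique\<close>)
  have "(\<lambda>(x, t). ennreal (indicator {0<..} t * H x t)) \<in> borel_measurable (borel \<Otimes>\<^sub>M exp_measure)"
    unfolding exp_measure_def by measurable
  then have "(\<lambda>x. \<integral>\<^sup>+t. ennreal (indicator {0<..} t * H x t) \<partial>exp_measure) \<in> borel_measurable borel"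
    by (rule borel_measurable_nn_integral)
  then show ?thesis by (simp add: green_eq_exp_measure[abs_def])
qed

lemma Lp_norm_green_translate: "Lp_norm p (green H x0) = Lp_norm p (green H 0)"
proof -
  note [measurable] = green_measurable
  have "(\<integral>\<^sup>+x. epowr (green H 0 (- x0 + x)) p \<partial>lborel) = (\<integral>\<^sup>+x. epowr (green H 0 x) p \<partial>lborel)"
    by (rule lborel_nn_integral_translate) measurable
  then show ?thesis by (simp add: Lp_norm_def green_translate[of H x0])
qed

text \<open>
  Interpolation between the supremum bound and the mass bound of the heat kernel.
\<close>

lemma nn_integral_H_powr_le:
  assumes C: "C > 0" "\<And>x. H x t \<le> C * t powr - q * exp t" and t: "t > 0" and p: "p \<ge> 1"
  shows "(\<integral>\<^sup>+x. ennreal (H x t powr p) \<partial>lborel) \<le> ennreal ((C * t powr - q * exp t) powr (p - 1))"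
proof -
  note h = sub_density_H[OF t]
  note [measurable] = sub_density_measurable[OF h]
  have H0: "0 \<le> H x t" for x using h by (simp add: sub_density_def)
  let ?b = "(C * t powr - q * exp t) powr (p - 1)"
  have "(\<integral>\<^sup>+x. ennreal (H x t powr p) \<partial>lborel) \<le> (\<integral>\<^sup>+x. ennreal ?b * ennreal (H x t) \<partial>lborel)"
  proof (intro nn_integral_mono)
    fix x
    have "H x t powr p \<le> ?b * H x t"
    proof (cases "H x t = 0")
      case False
      then have pos: "H x t > 0" using H0[of x] by simp
      then have "H x t powr p = H x t powr (p - 1) * H x t"
        by (simp add: powr_diff)
      also have "\<dots> \<le> ?b * H x t"
        using pos C(2) p by (intro mult_right_mono powr_mono2) auto
      finally show ?thesis .
    qed (use p in auto)
    then show "ennreal (H x t powr p) \<le> ennreal ?b * ennreal (H x t)"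
      using H0[of x] by (simp add: ennreal_mult[symmetric] ennreal_leI)
  qed
  also have "\<dots> = ennreal ?b * (\<integral>\<^sup>+x. ennreal (H x t) \<partial>lborel)"
    by (rule nn_integral_cmult) measurable
  also have "(\<integral>\<^sup>+x. ennreal (H x t) \<partial>lborel) = ennreal (\<integral>x. H x t \<partial>lborel)"
    using h H0 by (intro nn_integral_eq_integral) (auto simp: sub_density_def)
  also have "ennreal ?b * \<dots> \<le> ennreal ?b * 1"
    using h by (intro mult_left_mono) (auto simp: sub_density_def)
  finally show ?thesis by simp
qed

text \<open>
  With this exponent \<open>q (p - 1) = 1/2\<close>, so that the \<open>p\<close>-th powers of the time slices have mass
  of order \<open>t\<^sup>-\<^sup>1\<^sup>/\<^sup>2 e\<^sup>(\<^sup>p\<^sup>-\<^sup>1\<^sup>)\<^sup>t\<close>. This is integrable at \<open>0\<close>, and since \<open>p - 1 < 1/2\<close> the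
  weight \<open>e\<^sup>-\<^sup>t\<close> leaves exponential decay at infinity.
\<close>

lemma Lp_norm_green_finite:
  assumes p: "p = 1 + 1 / (2 * q)" and q: "q > 1"
  shows "Lp_norm p (green H 0) < \<infinity>"
proof -
  obtain C where C: "C > 0" "\<And>x t. t > 0 \<Longrightarrow> H x t \<le> C * t powr - q * exp t"
    using heat_kernel_le by blast
  have p1: "p > 1" "p - 1 \<le> 1 / 2" "q * (p - 1) = 1 / 2" using q by (auto simp: p field_simps)
  let ?w = "\<lambda>t::real. ennreal (exp (- t)) * indicator {0<..} t"
  let ?h = "\<lambda>x t. ennreal ((indicator {0<..} t * H x t) powr p)"
  note [measurable] = H_jointly_measurable H_measurable_at
  have "(\<integral>\<^sup>+x. epowr (green H 0 x) p \<partial>lborel)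
      \<le> (\<integral>\<^sup>+x. (\<integral>\<^sup>+t. ?h x t \<partial>exp_measure) \<partial>lborel)"
  proof (intro nn_integral_mono)
    fix x
    show "epowr (green H 0 x) p \<le> (\<integral>\<^sup>+t. ?h x t \<partial>exp_measure)"
      unfolding green_eq_exp_measure
    proof (rule epowr_nn_integral_le[OF emeasure_exp_measure_le_1 p1(1)])
      show "(\<lambda>t. indicator {0<..} t * H x t) \<in> borel_measurable exp_measure"
        unfolding exp_measure_def by measurable
      show "0 \<le> indicator {0<..} t * H x t" for t
        using kernel by (auto simp: heat_kernel_def indicator_def)
    qed
  qed
  also have "\<dots> = (\<integral>\<^sup>+x. (\<integral>\<^sup>+t. ?w t * ?h x t \<partial>lborel) \<partial>lborel)"
    unfolding exp_measure_def by (intro nn_integral_cong nn_integral_density) measurable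
  also have "\<dots> = (\<integral>\<^sup>+t. (\<integral>\<^sup>+x. ?w t * ?h x t \<partial>lborel) \<partial>lborel)"
    by (rule lborel_pair.Fubini') measurable
  also have "\<dots> \<le> (\<integral>\<^sup>+t. ennreal (C powr (p - 1)) *
      (ennreal (t powr (- 1 / 2) * exp (- t / 2)) * indicator {0<..} t) \<partial>lborel)"
  proof (intro nn_integral_mono)
    fix t :: real
    show "(\<integral>\<^sup>+x. ?w t * ?h x t \<partial>lborel)
      \<le> ennreal (C powr (p - 1)) * (ennreal (t powr (- 1 / 2) * exp (- t / 2)) * indicator {0<..} t)"
    proof (cases "t > 0")
      case True
      note [measurable] = sub_density_measurable[OF sub_density_H[OF True]]
      have "(\<integral>\<^sup>+x. ?w t * ?h x t \<partial>lborel) = ennreal (exp (- t)) * (\<integral>\<^sup>+x. ennreal (H x t powr p) \<partial>lborel)"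
        using True by (simp add: nn_integral_cmult)
      also have "\<dots> \<le> ennreal (exp (- t)) * ennreal ((C * t powr - q * exp t) powr (p - 1))"
        using C True p1 by (intro mult_left_mono nn_integral_H_powr_le) auto
      also have "\<dots> = ennreal (exp (- t) * (C * t powr - q * exp t) powr (p - 1))"
        by (simp add: ennreal_mult)
      also have "\<dots> \<le> ennreal (C powr (p - 1) * (t powr (- 1 / 2) * exp (- t / 2)))"
      proof (rule ennreal_leI)
        have "(C * t powr - q * exp t) powr (p - 1)
            = C powr (p - 1) * t powr (- (q * (p - 1))) * exp (t * (p - 1))"
          using C(1) True by (simp add: powr_mult powr_powr exp_powr_real)
        then have "exp (- t) * (C * t powr - q * exp t) powr (p - 1)
            = C powr (p - 1) * t powr (- 1 / 2) * exp (- t + t * (p - 1))"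
          unfolding p1(3) exp_add by simp
        also have "\<dots> \<le> C powr (p - 1) * t powr (- 1 / 2) * exp (- t / 2)"
        proof -
          have "t * (p - 1) \<le> t * (1 / 2)" using True p1 by (intro mult_left_mono) auto
          then show ?thesis by (intro mult_left_mono) auto
        qed
        finally show "exp (- t) * (C * t powr - q * exp t) powr (p - 1)
            \<le> C powr (p - 1) * (t powr (- 1 / 2) * exp (- t / 2))" by (simp add: mult.assoc)
      qed
      finally show ?thesis using True by (simp add: ennreal_mult)
    qed simp
  qed
  also have "\<dots> = ennreal (C powr (p - 1)) *
      (\<integral>\<^sup>+t. ennreal (t powr (- 1 / 2) * exp (- t / 2)) * indicator {0<..} (t::real) \<partial>lborel)"
    by (rule nn_integral_cmult) measurable
  also have "\<dots> < \<infinity>"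
    using nn_integral_inverse_sqrt_exp_finite by (simp add: ennreal_mult_less_top)
  finally show ?thesis by (auto simp: Lp_norm_def epowr_def)
qed

end

theorem lemma7p26:
  fixes \<mu> :: "(real ^ 'n) measure"
    and H :: "real ^ 'n \<Rightarrow> real \<Rightarrow> real"
    and \<alpha> C1 C2 C3 :: real
  assumes dim: "CARD('n) \<ge> 3"
    and alpha: "0 < \<alpha>" "\<alpha> < 2"
    and constants: "C1 > 0" "C2 > 0" "C3 > 0"
    and radon: "radon_punctured \<mu>"
    and symmetric: "symmetric_measure \<mu>"
    and levy: "levy_integrable \<mu>"
    and ac: "absolutely_continuous lborel_punctured \<mu>"
    and near: "AE z in lborel_punctured. norm z \<le> 1 \<longrightarrow>
        ennreal (C1 / norm z powr (real CARD('n) + \<alpha>)) \<le> RN_deriv lborel_punctured \<mu> z \<and>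
        RN_deriv lborel_punctured \<mu> z \<le> ennreal (C2 / norm z powr (real CARD('n) + \<alpha>))"
    and far: "AE z in lborel_punctured. norm z > 1 \<longrightarrow>
        RN_deriv lborel_punctured \<mu> z \<le> ennreal C3"
    and kernel: "heat_kernel \<mu> H"
  shows "(\<exists>C>0. \<forall>x0 x. \<forall>t>0.
            heat_kernel_at H x0 x t \<le> C * t powr (- (real CARD('n) / \<alpha>)) * exp t) \<and>
         (\<exists>p Cp. 1 < p \<and> p < real CARD('n) / (real CARD('n) - \<alpha>) \<and>
            (\<forall>x0. Lp_norm p (green H x0) = Lp_norm p (green H 0) \<and>
                  Lp_norm p (green H 0) \<le> ennreal Cp))"
proof -
  define q where "q = real CARD('n) / \<alpha>"
  interpret stable_like_heat_kernel \<mu> H \<alpha> C1 q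
  proof
    show "AE z in lborel_punctured. norm z \<le> 1 \<longrightarrow>
        ennreal (C1 / norm z powr (real DIM(real ^ 'n) + \<alpha>)) \<le> RN_deriv lborel_punctured \<mu> z"
      using near by (rule AE_mp) auto
  qed (use alpha constants radon symmetric levy ac kernel in \<open>auto simp: q_def\<close>)
  have q: "q > 1" using dim alpha by (simp add: q_def)
  define p where "p = 1 + 1 / (2 * q)"
  have "p < 1 + 1 / q" using q by (simp add: p_def field_simps)
  also have "\<dots> \<le> real CARD('n) / (real CARD('n) - \<alpha>)"
    using dim alpha by (simp add: q_def field_simps)
  finally have p: "1 < p" "p < real CARD('n) / (real CARD('n) - \<alpha>)"
    using q by (auto simp: p_def)
  obtain C where C: "C > 0" "\<And>x t. t > 0 \<Longrightarrow> H x t \<le> C * t powr - q * exp t"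
    using heat_kernel_le by blast
  then have "\<exists>C>0. \<forall>x0 x. \<forall>t>0.
      heat_kernel_at H x0 x t \<le> C * t powr (- (real CARD('n) / \<alpha>)) * exp t"
    by (intro exI[of _ C]) (auto simp: heat_kernel_at_def q_def)
  moreover have "Lp_norm p (green H 0) = ennreal (enn2real (Lp_norm p (green H 0)))"
    using Lp_norm_green_finite[OF p_def q] by simp
  ultimately show ?thesis
    using p Lp_norm_green_translate by (metis order_refl)
qed

end
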